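(* Consider the optimal control problem $$\min \int_0^T\big(y^TYy+y^TNu+\ell^Tu\big)\,dt\quad\text{s.t.}\quad \dot x=(J-R)Qx+Gu,\quad x(0)=x^0,\quad y=G^TQx,\quad \underline u_i\le u_i(t)\le\overline u_i,\ i=1,\dots,m,$$ with controls $u\in L^\infty([0,T];\mathbb{R}^m)$. Let $u^*$ be an optimal control with associated state $x$ and adjoint state $\lambda$. Then the following hold. (Goh conditions) For $i,j\in\{1,\dots,m\}$, on any open subinterval $(a,b)$ of $[0,T]$ on which $\underline u_i<u_i^*(t)<\overline u_i$ and $\underline u_j<u_j^*(t)<\overline u_j$, $$\begin{bmatrix}\lambda\\ 1\end{bmatrix}^T[f_i,f_j]=n_j^TG^TQg_i-n_i^TG^TQg_j=0 .$$ (Generalized Legendre-Clebsch condition) For any $\mathcal{I}\subseteq\{1,\dots,m\}$, on any open interval $(a,b)\subset[0,T]$ contained in $\bigcap_{i\in\mathcal{I}}W_i$, the matrix $$N_{\mathcal{I}}^TG^TQAG_{\mathcal{I}}-2\,G_{\mathcal{I}}^TQG\,Y\,G^TQG_{\mathcal{I}}+\big(N_{\mathcal{I}}^TG^TQAG_{\mathcal{I}}\big)^T$$ is negative semidefinite.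
   Context: Data: $J\in\mathbb{R}^{n,n}$ is skew-symmetric; $R\in\mathbb{R}^{n,n}$ is symmetric positive semidefinite; $Q\in\mathbb{R}^{n,n}$ is symmetric positive definite; $G=[g_1\,\dots\,g_m]\in\mathbb{R}^{n,m}$ (columns $g_i$) has full rank $m\le n$; $Y\in\mathbb{R}^{m,m}$ is symmetric positive semidefinite; $N=[n_1\,\dots\,n_m]\in\mathbb{R}^{m,m}$ (columns $n_i$); $\ell=(\ell_1,\dots,\ell_m)^T\in\mathbb{R}^m$; $\underline u_i\le\overline u_i$ are real numbers. Set $A=(J-R)Q$. States belong to $W^{1,\infty}([0,T];\mathbb{R}^n)$; conditions on controls are understood for almost every time. Writing the problem with an extra state $x_{n+1}$, $\dot x_{n+1}=y^TYy+y^TNu+\ell^Tu$, $x_{n+1}(0)=0$, and cost $x_{n+1}(T)$, the vector fields on $\mathbb{R}^{n+1}$ are $$f_0=\begin{bmatrix}Ax\\ x^TQGYG^TQx\end{bmatrix},\qquad f_i=\begin{bmatrix}g_i\\ x^TQGn_i+\ell_i\end{bmatrix},\ i=1,\dots,m,$$ and the Lie bracket is $[h,k]=k'h-h'k$ (prime = Jacobian). Adjoint state: the multiplier of $x_{n+1}$ is normalized to $1$, and $\lambda$ solves $\dot\lambda^T=-\lambda^TA-\big(x^TQG(Y+Y^T)G^TQ+u^{*T}N^TG^TQ\big)$, $\lambda(T)=0$. Interior sets: $W_i=\{t\in[0,T]:\underline u_i<u_i^*(t)<\overline u_i\}$. For $\mathcal{I}\subseteq\{1,\dots,m\}$, $G_{\mathcal{I}}$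 and $N_{\mathcal{I}}$ denote the submatrices of $G$ and $N$ consisting of the columns with index in $\mathcal{I}$. *)

theory Defs
  imports "HOL-Analysis.Analysis"
begin

definition pos_semidef :: "real^'k^'k \<Rightarrow> bool" where
  "pos_semidef M \<longleftrightarrow> transpose M = M \<and> (\<forall>v. 0 \<le> v \<bullet> (M *v v))"

definition pos_def :: "real^'k^'k \<Rightarrow> bool" where
  "pos_def M \<longleftrightarrow> transpose M = M \<and> (\<forall>v. v \<noteq> 0 \<longrightarrow> 0 < v \<bullet> (M *v v))"

text \<open>
  The submatrix of \<open>M\<close> made of the columns with index in \<open>I\<close>. Since \<open>I\<close> is a set and not a type, the
  submatrix is stored in a matrix of the size of \<open>M\<close>, with zeros in the positions outside \<open>I\<close>.
  In products such as \<open>transpose (col_submatrix I L) ** K ** col_submatrix I M\<close>, the entries with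
  both indices in \<open>I\<close> are those of the product formed with the true submatrices.
\<close>

definition col_submatrix :: "'k set \<Rightarrow> real^'k^'r \<Rightarrow> real^'k^'r" where
  "col_submatrix I M = (\<chi> r c. if c \<in> I then M $ r $ c else 0)"

text \<open>
  Negative semidefiniteness of a matrix whose rows and columns are indexed by \<open>I\<close>: only the
  entries with both indices in \<open>I\<close> belong to the matrix, the others are ignored.
\<close>

definition neg_semidef_on :: "'k set \<Rightarrow> real^'k^'k \<Rightarrow> bool" where
  "neg_semidef_on I M \<longleftrightarrow>
     (\<forall>i\<in>I. \<forall>j\<in>I. M $ i $ j = M $ j $ i) \<and>
     (\<forall>v :: 'k \<Rightarrow> real. (\<Sum>i\<in>I. \<Sum>j\<in>I. v i * M $ i $ j * v j) \<le> 0)"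

definition Linfty :: "real \<Rightarrow> (real \<Rightarrow> 'a::euclidean_space) \<Rightarrow> bool" where
  "Linfty T f \<longleftrightarrow>
     f \<in> borel_measurable (lebesgue_on {0..T}) \<and>
     (\<exists>C. AE t in lebesgue_on {0..T}. norm (f t) \<le> C)"

text \<open>
  \<open>W1infty_deriv T x v\<close>: the function \<open>x\<close> is (the continuous representative of) an element of
  \<open>W\<^sup>1\<^sup>,\<^sup>\<infinity>([0,T])\<close> and \<open>v\<close> is its weak derivative.
\<close>

definition W1infty_deriv ::
  "real \<Rightarrow> (real \<Rightarrow> 'a::euclidean_space) \<Rightarrow> (real \<Rightarrow> 'a) \<Rightarrow> bool" where
  "W1infty_deriv T x v \<longleftrightarrow>
     Linfty T v \<and> (\<forall>t\<in>{0..T}. x t = x 0 + (LINT s|lebesgue_on {0..t}. v s))"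

definition admissible_control ::
  "real \<Rightarrow> real^'m \<Rightarrow> real^'m \<Rightarrow> (real \<Rightarrow> real^'m) \<Rightarrow> bool" where
  "admissible_control T lo hi u \<longleftrightarrow>
     Linfty T u \<and>
     (AE t in lebesgue_on {0..T}. \<forall>i. lo $ i \<le> u t $ i \<and> u t $ i \<le> hi $ i)"

definition state_trajectory ::
  "real \<Rightarrow> real^'n^'n \<Rightarrow> real^'n^'n \<Rightarrow> real^'n^'n \<Rightarrow> real^'m^'n \<Rightarrow> real^'n \<Rightarrow>
   (real \<Rightarrow> real^'m) \<Rightarrow> (real \<Rightarrow> real^'n) \<Rightarrow> bool" where
  "state_trajectory T J R Q G x0 u x \<longleftrightarrow>
     x 0 = x0 \<and>
     (\<exists>v. W1infty_deriv T x v \<and>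
          (AE t in lebesgue_on {0..T}. v t = ((J - R) ** Q) *v x t + G *v u t))"

definition running_cost ::
  "real^'n^'n \<Rightarrow> real^'m^'n \<Rightarrow> real^'m^'m \<Rightarrow> real^'m^'m \<Rightarrow> real^'m \<Rightarrow>
   real^'n \<Rightarrow> real^'m \<Rightarrow> real" where
  "running_cost Q G Y N l x u =
     (let y = (transpose G ** Q) *v x in y \<bullet> (Y *v y) + y \<bullet> (N *v u) + l \<bullet> u)"

text \<open>
  The cost accumulated up to time \<open>t\<close>; as a function of \<open>t\<close> it is the extra state \<open>x\<^sub>n\<^sub>+\<^sub>1\<close>.
\<close>

definition cost ::
  "real^'n^'n \<Rightarrow> real^'m^'n \<Rightarrow> real^'m^'m \<Rightarrow> real^'m^'m \<Rightarrow> real^'m \<Rightarrow>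
   (real \<Rightarrow> real^'m) \<Rightarrow> (real \<Rightarrow> real^'n) \<Rightarrow> real \<Rightarrow> real" where
  "cost Q G Y N l u x t = (LINT s|lebesgue_on {0..t}. running_cost Q G Y N l (x s) (u s))"

definition optimal_control ::
  "real \<Rightarrow> real^'n^'n \<Rightarrow> real^'n^'n \<Rightarrow> real^'n^'n \<Rightarrow> real^'m^'n \<Rightarrow> real^'m^'m \<Rightarrow> real^'m^'m \<Rightarrow>
   real^'m \<Rightarrow> real^'m \<Rightarrow> real^'m \<Rightarrow> real^'n \<Rightarrow>
   (real \<Rightarrow> real^'m) \<Rightarrow> (real \<Rightarrow> real^'n) \<Rightarrow> bool" where
  "optimal_control T J R Q G Y N l lo hi x0 u x \<longleftrightarrow>
     admissible_control T lo hi u \<and> state_trajectory T J R Q G x0 u x \<and>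
     (\<forall>u' x'. admissible_control T lo hi u' \<and> state_trajectory T J R Q G x0 u' x' \<longrightarrow>
        cost Q G Y N l u x T \<le> cost Q G Y N l u' x' T)"

definition adjoint_state ::
  "real \<Rightarrow> real^'n^'n \<Rightarrow> real^'n^'n \<Rightarrow> real^'n^'n \<Rightarrow> real^'m^'n \<Rightarrow> real^'m^'m \<Rightarrow> real^'m^'m \<Rightarrow>
   (real \<Rightarrow> real^'m) \<Rightarrow> (real \<Rightarrow> real^'n) \<Rightarrow> (real \<Rightarrow> real^'n) \<Rightarrow> bool" where
  "adjoint_state T J R Q G Y N u x lam \<longleftrightarrow>
     lam T = 0 \<and>
     (\<exists>v. W1infty_deriv T lam v \<and>
          (AE t in lebesgue_on {0..T}.
             v t = - (lam t v* ((J - R) ** Q))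
                   - (x t v* (Q ** G ** (Y + transpose Y) ** transpose G ** Q)
                      + u t v* (transpose N ** transpose G ** Q))))"

text \<open>
  The space \<open>\<real>\<^sup>n\<^sup>+\<^sup>1\<close> is rendered as the product \<open>(real^'n) \<times> real\<close>, whose inner product is the Euclidean
  one.
\<close>

definition control_field ::
  "real^'n^'n \<Rightarrow> real^'m^'n \<Rightarrow> real^'m^'m \<Rightarrow> real^'m \<Rightarrow> 'm \<Rightarrow>
   (real^'n) \<times> real \<Rightarrow> (real^'n) \<times> real" where
  "control_field Q G N l i z =
     (column i G, fst z \<bullet> ((Q ** G) *v column i N) + l $ i)"

text \<open>
  The sign convention is \<open>[h, k] = k' h - h' k\<close>; meant for differentiable vector fields.
\<close>

definition lie_bracket ::
  "('a::real_normed_vector \<Rightarrow> 'a) \<Rightarrow> ('a \<Rightarrow> 'a) \<Rightarrow> 'a \<Rightarrow> 'a" where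
  "lie_bracket h k z = frechet_derivative k (at z) (h z) - frechet_derivative h (at z) (k z)"

definition interior_times ::
  "real \<Rightarrow> real^'m \<Rightarrow> real^'m \<Rightarrow> (real \<Rightarrow> real^'m) \<Rightarrow> 'm \<Rightarrow> real set" where
  "interior_times T lo hi u i = {t \<in> {0..T}. lo $ i < u t $ i \<and> u t $ i < hi $ i}"

end

theory Submission
  imports Defs
begin

text \<open>
  The problem is linear-quadratic, so both conditions follow from the second variation of the cost. Let \<open>w\<close> be a control variation that is supported where \<open>u\<close> is
  interior, and let \<open>z\<close> be the state that it produces from \<open>z(0) = 0\<close>. The cost along \<open>u + e w\<close> is a
  quadratic polynomial in \<open>e\<close> with leading coefficient
    \<open>q(w) = \<integral> (C z)\<^sup>T Y (C z) + (C z)\<^sup>T N w\<close>, where \<open>C = G\<^sup>T Q\<close>,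
  and optimality forces \<open>q(w) \<ge> 0\<close> (\<open>second_variation_nonneg\<close>).

  Take \<open>w = W'\<close> for a loop \<open>W\<close> with \<open>W(0) = W(T) = 0\<close>. Then \<open>z = G W + e\<close>, where \<open>e\<close> solves \<open>e' = A z\<close> and
  is of the order of the integral of \<open>|W|\<close>. An integration by parts
  gives (\<open>second_variation_expansion\<close>)
    \<open>q(w) = \<integral> (C G W)\<^sup>T N W' + \<integral> ((C G W)\<^sup>T Y (C G W) - (C A G W)\<^sup>T N W) + O((\<integral> |W|)\<^sup>2)\<close>.
  If \<open>W\<close> is a fixed loop run through in a time \<open>h\<close>, the three terms are of order \<open>1\<close>, \<open>h\<close> and \<open>h\<^sup>2\<close>
  (\<open>shrinking_loop_conditions\<close>). The first term is the antisymmetric part of \<open>G\<^sup>T Q G N\<close> weighted with the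
  area that the loop encloses. As it cannot be negative for either orientation of a planar loop, the
  antisymmetric part vanishes, which is the Goh condition (\<open>goh_inequality\<close>). For a loop along a fixed
  direction \<open>v\<close> the first term is zero. The second term is then nonnegative and is a positive multiple of
  \<open>(C G v)\<^sup>T Y (C G v) - (C A G v)\<^sup>T N v\<close>, which is the Legendre-Clebsch condition (\<open>legendre_clebsch_form_nonneg\<close>).

  The vector fields \<open>f\<^sub>i\<close> have a constant part \<open>g\<^sub>i\<close>, so their brackets only have a component along the
  cost variable (\<open>lie_bracket_control_fields\<close>). There the multiplier is \<open>1\<close>, which yields the formula for
  the bracket paired with the adjoint vector.
\<close>

section \<open>Linear Volterra equations\<close>

text \<open>
  The solution is the sum of the Picard iterates \<open>f n\<close> that start from the datum \<open>p\<close>. The bound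
  \<open>c (K t)\<^sup>n / n!\<close> on the iterates gives uniform convergence and the constant \<open>exp (K T)\<close>. What matters
  below is that the constant depends on the equation only: it makes responses to small data small.
\<close>

lemma volterra_bounded_solvability:
  fixes L :: "'a::euclidean_space \<Rightarrow> 'a"
    and T :: real
  assumes L: "bounded_linear L" and T: "0 \<le> T"
  obtains C where "0 \<le> C"
    and "\<And>p c. continuous_on {0..T} p \<Longrightarrow> (\<And>t. t \<in> {0..T} \<Longrightarrow> norm (p t) \<le> c) \<Longrightarrow>
      \<exists>z. continuous_on {0..T} z \<and>
          (\<forall>t\<in>{0..T}. norm (z t) \<le> C * c \<and> z t = p t + integral {0..t} (\<lambda>s. L (z s)))"
proof -
  obtain K where K: "0 < K" "\<And>x. norm (L x) \<le> norm x * K"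
    using bounded_linear.pos_bounded[OF L] by blast
  have contL: "continuous_on {0..t} (\<lambda>s. L (f s))" if "continuous_on {0..T} f" "t \<le> T" for f :: "real \<Rightarrow> 'a" and t
    by (intro bounded_linear.continuous_on[OF L] continuous_on_subset[OF that(1)]) (use that(2) in auto)
  have "\<exists>z. continuous_on {0..T} z \<and>
        (\<forall>t\<in>{0..T}. norm (z t) \<le> exp (K * T) * c \<and> z t = p t + integral {0..t} (\<lambda>s. L (z s)))"
    if p: "continuous_on {0..T} p" and c: "\<And>t. t \<in> {0..T} \<Longrightarrow> norm (p t) \<le> c" for p :: "real \<Rightarrow> 'a" and c
  proof -
    define f where "f = rec_nat p (\<lambda>_ g t. integral {0..t} (\<lambda>s. L (g s)))"
    have f0: "f 0 = p" and fS: "f (Suc n) = (\<lambda>t. integral {0..t} (\<lambda>s. L (f n s)))" for n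
      by (simp_all add: f_def)
    have contf: "continuous_on {0..T} (f n)" for n
    proof (induction n)
      case (Suc n)
      show ?case unfolding fS
        by (intro indefinite_integral_continuous_1 integrable_continuous_real contL Suc order_refl)
    qed (simp add: f0 p)
    have c0: "0 \<le> c" using c[of 0] T by (meson atLeastAtMost_iff norm_ge_zero order_refl order_trans)
    have bound: "norm (f n t) \<le> c * ((K * t) ^ n / fact n)" if "t \<in> {0..T}" for n t
      using that
    proof (induction n arbitrary: t)
      case (Suc n)
      have hi: "((\<lambda>s. c * (K * (K * s) ^ n / fact n)) has_integral
             (c * ((K * t) ^ Suc n / fact (Suc n)) - c * ((K * 0) ^ Suc n / fact (Suc n)))) {0..t}"
      proof (rule fundamental_theorem_of_calculus)
        fix s assume "s \<in> {0..t}"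
        have "((\<lambda>s. c * ((K * s) ^ Suc n / fact (Suc n))) has_real_derivative
            c * (real (Suc n) * (K * s) ^ n * K / fact (Suc n))) (at s within {0..t})"
          by (auto intro!: derivative_eq_intros simp del: fact_Suc power_Suc)
        also have "c * (real (Suc n) * (K * s) ^ n * K / fact (Suc n)) = c * (K * (K * s) ^ n / fact n)"
          by (simp add: field_simps del: of_nat_Suc)
        finally show "((\<lambda>s. c * ((K * s) ^ Suc n / fact (Suc n))) has_vector_derivative
            c * (K * (K * s) ^ n / fact n)) (at s within {0..t})"
          by (simp add: has_real_derivative_iff_has_vector_derivative)
      qed (use Suc.prems in auto)
      have "norm (integral {0..t} (\<lambda>s. L (f n s))) \<le> integral {0..t} (\<lambda>s. c * (K * (K * s) ^ n / fact n))"
      proof (rule integral_norm_bound_integral)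
        show "(\<lambda>s. L (f n s)) integrable_on {0..t}"
          using Suc.prems by (intro integrable_continuous_real contL contf) auto
        fix s assume "s \<in> {0..t}"
        then have "norm (f n s) \<le> c * ((K * s) ^ n / fact n)" using Suc by auto
        then have "norm (f n s) * K \<le> c * ((K * s) ^ n / fact n) * K"
          using K(1) by (intro mult_right_mono) auto
        then show "norm (L (f n s)) \<le> c * (K * (K * s) ^ n / fact n)"
          using K(2)[of "f n s"] by (simp add: mult_ac)
      qed (use hi in \<open>auto simp: has_integral_integrable\<close>)
      also have "\<dots> = c * ((K * t) ^ Suc n / fact (Suc n))"
        using integral_unique[OF hi] by simp
      finally show ?case by (simp add: fS)
    qed (use c f0 in auto)
    define M where "M n = c * ((K * T) ^ n / fact n)" for n
    have boundM: "norm (f n t) \<le> M n" if "t \<in> {0..T}" for n t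
    proof -
      have "c * ((K * t) ^ n / fact n) \<le> M n" unfolding M_def
        using that K(1) c0 by (intro mult_left_mono divide_right_mono power_mono) auto
      then show ?thesis using bound[OF that, of n] by linarith
    qed
    have Msums: "M sums (c * exp (K * T))" unfolding M_def
      using exp_converges[of "K * T"] by (intro sums_mult) (simp add: divide_inverse mult.commute)
    define z where "z t = (\<Sum>n. f n t)" for t
    have ul: "uniform_limit {0..T} (\<lambda>n t. \<Sum>i<n. f i t) z sequentially"
      unfolding z_def using boundM Msums by (intro Weierstrass_m_test) (auto simp: sums_iff)
    have contS: "continuous_on {0..T} (\<lambda>t. \<Sum>i<n. f i t)" for n
      by (intro continuous_on_sum contf)
    have contz: "continuous_on {0..T} z"
      by (rule uniform_limit_theorem[OF _ ul]) (simp_all add: contS)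
    have "norm (z t) \<le> exp (K * T) * c \<and> z t = p t + integral {0..t} (\<lambda>s. L (z s))"
      if t: "t \<in> {0..T}" for t
    proof
      have sn: "summable (\<lambda>n. norm (f n t))"
        by (rule summable_comparison_test[of _ M]) (use boundM[OF t] Msums in \<open>auto simp: sums_iff\<close>)
      have "norm (z t) \<le> (\<Sum>n. norm (f n t))" unfolding z_def by (rule summable_norm[OF sn])
      also have "\<dots> \<le> (\<Sum>n. M n)"
        using boundM[OF t] sn Msums by (intro suminf_le) (auto simp: sums_iff)
      finally show "norm (z t) \<le> exp (K * T) * c" using Msums by (simp add: sums_iff mult.commute)
      have ulL: "uniform_limit {0..t} (\<lambda>n s. L (\<Sum>i<n. f i s)) (\<lambda>s. L (z s)) sequentially"
        using t by (intro bounded_linear.uniform_limit[OF L] uniform_limit_on_subset[OF ul]) auto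
      have S: "(\<Sum>i<Suc n. f i t) = p t + integral {0..t} (\<lambda>s. L (\<Sum>i<n. f i s))" for n
      proof -
        have "(\<Sum>i<Suc n. f i t) = p t + (\<Sum>i<n. integral {0..t} (\<lambda>s. L (f i s)))"
          unfolding sum.lessThan_Suc_shift by (simp add: f0 fS)
        also have "(\<Sum>i<n. integral {0..t} (\<lambda>s. L (f i s))) = integral {0..t} (\<lambda>s. \<Sum>i<n. L (f i s))"
          using t by (intro integral_sum[symmetric] integrable_continuous_real contL contf) auto
        finally show ?thesis using L by (simp add: bounded_linear.linear linear_sum)
      qed
      obtain I J where I: "\<And>n. ((\<lambda>s. L (\<Sum>i<n. f i s)) has_integral I n) (cbox 0 t)"
        and J: "((\<lambda>s. L (z s)) has_integral J) (cbox 0 t)" and IJ: "(I \<longlongrightarrow> J) sequentially"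
      proof (rule uniform_limit_integral_cbox)
        show "uniform_limit (cbox 0 t) (\<lambda>n s. L (\<Sum>i<n. f i s)) (\<lambda>s. L (z s)) sequentially"
          using ulL by simp
        show "\<And>n. continuous_on (cbox 0 t) (\<lambda>s. L (\<Sum>i<n. f i s))"
          using t contL[OF contS] by simp
      qed auto
      have "(\<lambda>n. p t + integral {0..t} (\<lambda>s. L (\<Sum>i<n. f i s))) \<longlonglongrightarrow> p t + integral {0..t} (\<lambda>s. L (z s))"
        using integral_unique[OF I] integral_unique[OF J] IJ by (intro tendsto_add tendsto_const) simp
      moreover have "(\<lambda>n. \<Sum>i<Suc n. f i t) \<longlonglongrightarrow> z t"
        using LIMSEQ_Suc[OF tendsto_uniform_limitI[OF ul t]] .
      ultimately show "z t = p t + integral {0..t} (\<lambda>s. L (z s))"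
        unfolding S by (rule LIMSEQ_unique[rotated])
    qed
    then show ?thesis using contz by blast
  qed
  then show ?thesis by (intro that[of "exp (K * T)"]) auto
qed

section \<open>Essentially bounded functions and state trajectories\<close>

lemma Linfty_iff:
  "Linfty T f \<longleftrightarrow> f \<in> borel_measurable (lebesgue_on {0..T}) \<and>
     (\<exists>C\<ge>0. AE t in lebesgue_on {0..T}. norm (f t) \<le> C)"
proof -
  have "AE t in lebesgue_on {0..T}. norm (f t) \<le> max 0 C"
    if "AE t in lebesgue_on {0..T}. norm (f t) \<le> C" for C
    using that by eventually_elim auto
  then show ?thesis unfolding Linfty_def by (metis max.cobounded1)
qed

lemma Linfty_continuous:
  assumes "continuous_on {0..T} f" shows "Linfty T f"
proof -
  have "bounded (f ` {0..T})"
    using assms by (intro compact_imp_bounded compact_continuous_image) auto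
  then obtain C where "\<And>t. t \<in> {0..T} \<Longrightarrow> norm (f t) \<le> C" unfolding bounded_iff by blast
  then show ?thesis unfolding Linfty_def
    using continuous_imp_measurable_on_sets_lebesgue[OF assms] by (auto intro!: exI[of _ C] AE_I2)
qed

lemma Linfty_bounded_linear:
  assumes "Linfty T f" "bounded_linear L" shows "Linfty T (\<lambda>t. L (f t))"
proof -
  obtain C where C: "AE t in lebesgue_on {0..T}. norm (f t) \<le> C" and m: "f \<in> borel_measurable (lebesgue_on {0..T})"
    using assms(1) unfolding Linfty_def by blast
  obtain K where K: "0 < K" "\<And>x. norm (L x) \<le> norm x * K"
    using bounded_linear.pos_bounded[OF assms(2)] by blast
  have "AE t in lebesgue_on {0..T}. norm (L (f t)) \<le> C * K"
    using C by eventually_elim (use K in \<open>meson less_imp_le mult_right_mono order_trans\<close>)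
  moreover have "(\<lambda>t. L (f t)) \<in> borel_measurable (lebesgue_on {0..T})"
    using measurable_compose[OF m borel_measurable_continuous_onI[OF linear_continuous_on[OF assms(2)]]] .
  ultimately show ?thesis unfolding Linfty_def by blast
qed

lemma Linfty_add:
  assumes "Linfty T f" "Linfty T g" shows "Linfty T (\<lambda>t. f t + g t)"
proof -
  obtain C D where C: "AE t in lebesgue_on {0..T}. norm (f t) \<le> C" and D: "AE t in lebesgue_on {0..T}. norm (g t) \<le> D"
    using assms unfolding Linfty_def by blast
  have "AE t in lebesgue_on {0..T}. norm (f t + g t) \<le> C + D"
    using C D by eventually_elim (rule norm_triangle_mono)
  then show ?thesis using assms unfolding Linfty_def by (auto intro: borel_measurable_add)
qed

lemma Linfty_inner:
  assumes "Linfty T f" "Linfty T g" shows "Linfty T (\<lambda>t. f t \<bullet> g t)"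
proof -
  obtain C D where C: "0 \<le> C" "AE t in lebesgue_on {0..T}. norm (f t) \<le> C"
    and D: "AE t in lebesgue_on {0..T}. norm (g t) \<le> D"
    using assms unfolding Linfty_iff by blast
  have "AE t in lebesgue_on {0..T}. norm (f t \<bullet> g t) \<le> C * D"
    using C(2) D
  proof eventually_elim
    case (elim t)
    have "norm (f t \<bullet> g t) \<le> norm (f t) * norm (g t)" by (simp add: Cauchy_Schwarz_ineq2)
    also have "\<dots> \<le> C * D" using elim C(1) by (intro mult_mono) auto
    finally show ?case .
  qed
  then show ?thesis using assms unfolding Linfty_def by (auto intro: borel_measurable_inner)
qed

lemma Linfty_restrict:
  assumes "Linfty T f" "{t \<in> {0..T}. t \<in> E} \<in> sets (lebesgue_on {0..T})"
  shows "Linfty T (\<lambda>t. if t \<in> E then f t else 0)"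
proof -
  obtain C where C: "0 \<le> C" "AE t in lebesgue_on {0..T}. norm (f t) \<le> C"
    using assms unfolding Linfty_iff by blast
  have "AE t in lebesgue_on {0..T}. norm (if t \<in> E then f t else 0) \<le> C"
    using C(2) by eventually_elim (use C(1) in auto)
  moreover have "(\<lambda>t. if t \<in> E then f t else 0) \<in> borel_measurable (lebesgue_on {0..T})"
    using assms by (intro measurable_If) (auto simp: Linfty_def)
  ultimately show ?thesis unfolding Linfty_def by blast
qed

lemma Linfty_integrable:
  assumes "Linfty T f" shows "integrable (lebesgue_on {0..T}) f"
  using assms finite_measure.integrable_const_bound[OF finite_measure_lebesgue_on, of "{0..T}"]
  unfolding Linfty_def by fastforce

lemma AE_lebesgue_on_subset:
  fixes S T :: "real set"
  assumes "AE t in lebesgue_on T. P t" "S \<subseteq> T" "S \<in> sets lebesgue" "T \<in> sets lebesgue"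
  shows "AE t in lebesgue_on S. P t"
  using assms by (auto simp: AE_restrict_space_iff elim!: AE_mp)

lemma Linfty_shorter:
  assumes "Linfty T f" "t \<in> {0..T}" shows "Linfty t f"
proof -
  have "{0..t} \<subseteq> {0..T}" using assms(2) by auto
  then show ?thesis
    using assms(1) measurable_restrict_mono[of f lebesgue "{0..T}" borel "{0..t}"]
      AE_lebesgue_on_subset[where S = "{0..t}" and T = "{0..T}"]
    unfolding Linfty_def by (metis atLeastAtMost_borel sets_completionI_sets sets_lborel)
qed

lemma Linfty_integrals:
  assumes "Linfty T f" and t: "t \<in> {0..T}"
  shows "f integrable_on {0..t}"
    and "(LINT s|lebesgue_on {0..t}. f s) = integral {0..t} f"
proof -
  have "integrable (lebesgue_on {0..t}) f"
    by (rule Linfty_integrable[OF Linfty_shorter[OF assms]])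
  then show "f integrable_on {0..t}" "(LINT s|lebesgue_on {0..t}. f s) = integral {0..t} f"
    by (auto simp: lebesgue_integral_eq_integral integrable_on_lebesgue_on)
qed

text \<open>
  Bounded controls make the state a solution of an integral equation for the gauge integral, in which
  the weak derivative no longer appears and to which the fundamental theorem of calculus applies.
\<close>

lemma state_trajectory_iff_integral_equation:
  assumes u: "Linfty T u"
  shows "state_trajectory T J R Q G x0 u x \<longleftrightarrow>
    x 0 = x0 \<and> continuous_on {0..T} x \<and>
    (\<forall>t\<in>{0..T}. x t = x0 + integral {0..t} (\<lambda>s. ((J - R) ** Q) *v x s + G *v u s))"
    (is "?L \<longleftrightarrow> ?R")
proof -
  let ?f = "\<lambda>s. ((J - R) ** Q) *v x s + G *v u s"
  have f: "Linfty T ?f" if "continuous_on {0..T} x"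
    by (intro Linfty_add Linfty_bounded_linear[OF Linfty_continuous[OF that]]
        Linfty_bounded_linear[OF u] matrix_vector_mul_bounded_linear)
  show ?thesis
  proof
    assume ?L
    then obtain v where x0: "x 0 = x0" and v: "Linfty T v"
      and xv: "\<And>t. t \<in> {0..T} \<Longrightarrow> x t = x 0 + (LINT s|lebesgue_on {0..t}. v s)"
      and vf: "AE t in lebesgue_on {0..T}. v t = ?f t"
      unfolding state_trajectory_def W1infty_deriv_def by blast
    have xv': "x t = x0 + integral {0..t} v" if "t \<in> {0..T}" for t
      using xv[OF that] Linfty_integrals(2)[OF v that] x0 by simp
    have cont: "continuous_on {0..T} x"
    proof (cases "0 \<le> T")
      case True
      have "continuous_on {0..T} (\<lambda>t. x0 + integral {0..t} v)"
        using Linfty_integrals(1)[OF v, of T] True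
        by (intro continuous_intros indefinite_integral_continuous_1) auto
      then show ?thesis by (rule continuous_on_eq) (simp add: xv')
    qed auto
    have "x t = x0 + integral {0..t} ?f" if t: "t \<in> {0..T}" for t
    proof -
      have "AE t in lebesgue_on {0..t}. v t = ?f t"
        by (rule AE_lebesgue_on_subset[OF vf]) (use t in auto)
      then have "(LINT s|lebesgue_on {0..t}. v s) = (LINT s|lebesgue_on {0..t}. ?f s)"
        by (intro Bochner_Integration.integral_cong_AE)
           (use Linfty_shorter[OF v t] Linfty_shorter[OF f[OF cont] t] in \<open>auto simp: Linfty_def\<close>)
      then show ?thesis using xv[OF t] x0 Linfty_integrals(2)[OF f[OF cont] t] by simp
    qed
    with x0 cont show ?R by blast
  next
    assume R: ?R
    then have "Linfty T ?f" using f by blast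
    with R show ?L unfolding state_trajectory_def W1infty_deriv_def
      by (intro conjI exI[of _ ?f]) (auto simp: Linfty_integrals(2))
  qed
qed

section \<open>The second variation of the cost\<close>

lemma Linfty_running_cost:
  assumes "continuous_on {0..T} x" "Linfty T u"
  shows "Linfty T (\<lambda>t. running_cost Q G Y N l (x t) (u t))"
  unfolding running_cost_def Let_def
  by (intro Linfty_add Linfty_inner Linfty_bounded_linear[OF Linfty_continuous[OF assms(1)]]
      Linfty_bounded_linear[OF Linfty_bounded_linear[OF Linfty_continuous[OF assms(1)]]]
      Linfty_bounded_linear[OF assms(2)] assms(2) Linfty_continuous continuous_on_const
      matrix_vector_mul_bounded_linear)

lemma cost_eq_integral:
  assumes "continuous_on {0..T} x" "Linfty T u" "0 \<le> T"
  shows "cost Q G Y N l u x T = integral {0..T} (\<lambda>t. running_cost Q G Y N l (x t) (u t))"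
  unfolding cost_def using Linfty_integrals(2)[OF Linfty_running_cost[OF assms(1,2)]] assms(3) by simp

text \<open>
  The running cost is a quadratic polynomial in \<open>(x, u)\<close>, so its symmetric second difference is exact
  and consists of its quadratic part, which is the running cost with \<open>l = 0\<close>.
\<close>

lemma running_cost_parallelogram:
  "running_cost Q G Y N l (x + d *\<^sub>R z) (u + d *\<^sub>R w) + running_cost Q G Y N l (x + (- d) *\<^sub>R z) (u + (- d) *\<^sub>R w)
   = 2 * running_cost Q G Y N l x u + 2 * d\<^sup>2 * running_cost Q G Y N 0 z w"
  unfolding running_cost_def Let_def
  by (simp add: matrix_vector_right_distrib matrix_vector_mult_diff_distrib matrix_vector_mult_scaleR

      inner_add_left inner_add_right inner_diff_left inner_diff_right power2_eq_square algebra_simps)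

text \<open>
  The dynamics are affine, so \<open>x + e z\<close> is the state for the control \<open>u + e w\<close>. Comparing the optimal
  cost with the costs of both \<open>u + d w\<close> and \<open>u - d w\<close> cancels the first variation.
\<close>

lemma second_variation_nonneg_uniform:
  fixes u w :: "real \<Rightarrow> real^'m" and x z :: "real \<Rightarrow> real^'n"
  assumes T: "0 \<le> T" and opt: "optimal_control T J R Q G Y N l lo hi x0 u x"
    and w: "Linfty T w" and z: "state_trajectory T J R Q G 0 w z" and d: "0 < d"
    and adm: "AE t in lebesgue_on {0..T}. \<forall>i. lo $ i + d * \<bar>w t $ i\<bar> \<le> u t $ i \<and> u t $ i + d * \<bar>w t $ i\<bar> \<le> hi $ i"
  shows "0 \<le> cost Q G Y N 0 w z T"
proof -
  let ?A = "(J - R) ** Q"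
  have u: "Linfty T u" and x: "state_trajectory T J R Q G x0 u x"
    and le: "\<And>u' x'. admissible_control T lo hi u' \<Longrightarrow> state_trajectory T J R Q G x0 u' x' \<Longrightarrow>
        cost Q G Y N l u x T \<le> cost Q G Y N l u' x' T"
    using opt unfolding optimal_control_def admissible_control_def by auto
  have xc: "continuous_on {0..T} x" and x0: "x 0 = x0"
    and xe: "\<And>t. t \<in> {0..T} \<Longrightarrow> x t = x0 + integral {0..t} (\<lambda>s. ?A *v x s + G *v u s)"
    using x unfolding state_trajectory_iff_integral_equation[OF u] by auto
  have zc: "continuous_on {0..T} z" and z0: "z 0 = 0"
    and ze: "\<And>t. t \<in> {0..T} \<Longrightarrow> z t = 0 + integral {0..t} (\<lambda>s. ?A *v z s + G *v w s)"
    using z unfolding state_trajectory_iff_integral_equation[OF w] by auto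
  have int: "(\<lambda>s. ?A *v y s + G *v v s) integrable_on {0..t}"
    if "continuous_on {0..T} y" "Linfty T v" "t \<in> {0..T}" for y :: "real \<Rightarrow> real^'n" and v :: "real \<Rightarrow> real^'m" and t
    by (intro Linfty_integrals(1)[OF _ that(3)] Linfty_add Linfty_bounded_linear[OF Linfty_continuous[OF that(1)]]
        Linfty_bounded_linear[OF that(2)] matrix_vector_mul_bounded_linear)
  have ue: "Linfty T (\<lambda>t. u t + e *\<^sub>R w t)" for e
    by (intro Linfty_add u Linfty_bounded_linear[OF w] bounded_linear_scaleR_right)
  have xec: "continuous_on {0..T} (\<lambda>t. x t + e *\<^sub>R z t)" for e
    by (intro continuous_intros xc zc)
  have step: "cost Q G Y N l u x T \<le> cost Q G Y N l (\<lambda>t. u t + e *\<^sub>R w t) (\<lambda>t. x t + e *\<^sub>R z t) T"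
    if e: "\<bar>e\<bar> = d" for e
  proof (rule le)
    have "AE t in lebesgue_on {0..T}. \<forall>i. lo $ i \<le> (u t + e *\<^sub>R w t) $ i \<and> (u t + e *\<^sub>R w t) $ i \<le> hi $ i"
      using adm
    proof eventually_elim
      case (elim t)
      have "\<bar>e * w t $ i\<bar> = d * \<bar>w t $ i\<bar>" for i using e by (simp add: abs_mult)
      then show ?case using elim by (auto simp: abs_le_iff) (smt (verit))+
    qed
    then show "admissible_control T lo hi (\<lambda>t. u t + e *\<^sub>R w t)"
      unfolding admissible_control_def using ue by auto
    have "x t + e *\<^sub>R z t = x0 + integral {0..t} (\<lambda>s. ?A *v (x s + e *\<^sub>R z s) + G *v (u s + e *\<^sub>R w s))"
      if t: "t \<in> {0..T}" for t
    proof -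
      have "x t + e *\<^sub>R z t = x0 + (integral {0..t} (\<lambda>s. ?A *v x s + G *v u s)
           + integral {0..t} (\<lambda>s. e *\<^sub>R (?A *v z s + G *v w s)))"
        using xe[OF t] ze[OF t] by simp
      also have "\<dots> = x0 + integral {0..t} (\<lambda>s. (?A *v x s + G *v u s) + e *\<^sub>R (?A *v z s + G *v w s))"
        using int[OF xc u t] integrable_cmul[OF int[OF zc w t]] by (simp only: integral_add)
      finally show ?thesis
        by (simp add: matrix_vector_right_distrib matrix_vector_mult_scaleR scaleR_add_right algebra_simps)
    qed
    then show "state_trajectory T J R Q G x0 (\<lambda>t. u t + e *\<^sub>R w t) (\<lambda>t. x t + e *\<^sub>R z t)"
      unfolding state_trajectory_iff_integral_equation[OF ue] using xec x0 z0 by auto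
  qed
  define r where "r e t = running_cost Q G Y N l (x t + e *\<^sub>R z t) (u t + e *\<^sub>R w t)" for e t
  have ri: "r e integrable_on {0..T}" for e
    unfolding r_def using Linfty_integrals(1)[OF Linfty_running_cost[OF xec ue]] T by simp
  have r0i: "(\<lambda>t. running_cost Q G Y N l (x t) (u t)) integrable_on {0..T}"
    and rzi: "(\<lambda>t. running_cost Q G Y N 0 (z t) (w t)) integrable_on {0..T}"
    using Linfty_integrals(1)[OF Linfty_running_cost[OF xc u]] Linfty_integrals(1)[OF Linfty_running_cost[OF zc w]] T by auto
  have "2 * cost Q G Y N l u x T \<le> integral {0..T} (r d) + integral {0..T} (r (-d))"
    using step[of d] step[of "-d"] d unfolding cost_eq_integral[OF xec ue T] r_def by simp
  also have "\<dots> = integral {0..T} (\<lambda>t. r d t + r (-d) t)"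
    by (simp add: integral_add ri)
  also have "\<dots> = integral {0..T} (\<lambda>t. 2 * running_cost Q G Y N l (x t) (u t)
                     + 2 * d\<^sup>2 * running_cost Q G Y N 0 (z t) (w t))"
    unfolding r_def running_cost_parallelogram ..
  also have "\<dots> = 2 * cost Q G Y N l u x T + 2 * d\<^sup>2 * cost Q G Y N 0 w z T"
    unfolding cost_eq_integral[OF xc u T] cost_eq_integral[OF zc w T]
    using r0i rzi by (subst integral_add) (auto intro: integrable_on_mult_right simp: integral_mult_right)
  finally have "0 \<le> 2 * d\<^sup>2 * cost Q G Y N 0 w z T" by simp
  then show ?thesis using d by (simp add: zero_le_mult_iff)
qed

text \<open>
  The control may come arbitrarily close to its bounds on the set where it is interior, and then no
  nonzero multiple of \<open>w\<close> need be an admissible perturbation. Cutting \<open>w\<close> off outside the set \<open>E k\<close> where the distance to the bounds is at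
  least \<open>1 / (k + 1)\<close> makes small multiples admissible. These sets exhaust almost all of the relevant
  times, and the cost of the truncated variations converges by dominated convergence.
\<close>

lemma second_variation_nonneg:
  fixes u w :: "real \<Rightarrow> real^'m" and x z :: "real \<Rightarrow> real^'n"
  assumes T: "0 \<le> T" and opt: "optimal_control T J R Q G Y N l lo hi x0 u x"
    and w: "Linfty T w" and z: "state_trajectory T J R Q G 0 w z"
    and int: "AE t in lebesgue_on {0..T}. \<forall>i. w t $ i \<noteq> 0 \<longrightarrow> lo $ i < u t $ i \<and> u t $ i < hi $ i"
  shows "0 \<le> cost Q G Y N 0 w z T"
proof -
  let ?A = "(J - R) ** Q" and ?M = "lebesgue_on {0..T}"
  have u: "Linfty T u" and uadm: "AE t in ?M. \<forall>i. lo $ i \<le> u t $ i \<and> u t $ i \<le> hi $ i"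
    using opt unfolding optimal_control_def admissible_control_def by auto
  have zc: "continuous_on {0..T} z" and z0: "z 0 = 0"
    and ze: "\<And>t. t \<in> {0..T} \<Longrightarrow> z t = 0 + integral {0..t} (\<lambda>s. ?A *v z s + G *v w s)"
    using z unfolding state_trajectory_iff_integral_equation[OF w] by auto
  obtain B where B: "0 \<le> B" "AE t in ?M. norm (w t) \<le> B"
    using w unfolding Linfty_iff by blast
  define E where "E k = {t. \<forall>i. w t $ i \<noteq> 0 \<longrightarrow>
      lo $ i + 1 / real (Suc k) \<le> u t $ i \<and> u t $ i + 1 / real (Suc k) \<le> hi $ i}" for k
  define v where "v k t = (if t \<in> E k then w t else 0)" for k t
  have comp: "(\<lambda>t. f t $ i) \<in> borel_measurable ?M" if "Linfty T f" for f :: "real \<Rightarrow> real^'m" and i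
    using Linfty_bounded_linear[OF that bounded_linear_vec_nth] unfolding Linfty_def by blast
  have v: "Linfty T (v k)" for k
    unfolding v_def
  proof (rule Linfty_restrict[OF w])
    note [measurable] = comp[OF w] comp[OF u]
    have "{t \<in> space ?M. \<forall>i. w t $ i \<noteq> 0 \<longrightarrow>
      lo $ i + 1 / real (Suc k) \<le> u t $ i \<and> u t $ i + 1 / real (Suc k) \<le> hi $ i} \<in> sets ?M"
      by measurable
    then show "{t \<in> {0..T}. t \<in> E k} \<in> sets ?M" by (simp add: E_def)
  qed
  have vw: "Linfty T (\<lambda>t. G *v (v k t - w t))" for k
  proof (rule Linfty_bounded_linear[OF _ matrix_vector_mul_bounded_linear])
    show "Linfty T (\<lambda>t. v k t - w t)"
      using Linfty_add[OF v Linfty_bounded_linear[OF w bounded_linear_minus[OF bounded_linear_ident]]] by simp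
  qed
  have conv: "AE t in ?M. \<forall>\<^sub>F k in sequentially. v k t = w t"
    using int
  proof eventually_elim
    case (elim t)
    have "\<forall>\<^sub>F k in sequentially. \<forall>i. w t $ i \<noteq> 0 \<longrightarrow>
      lo $ i + 1 / real (Suc k) \<le> u t $ i \<and> u t $ i + 1 / real (Suc k) \<le> hi $ i"
    proof (rule eventually_all_finite)
      fix i
      show "\<forall>\<^sub>F k in sequentially. w t $ i \<noteq> 0 \<longrightarrow>
        lo $ i + 1 / real (Suc k) \<le> u t $ i \<and> u t $ i + 1 / real (Suc k) \<le> hi $ i"
      proof (cases "w t $ i = 0")
        case False
        define g where "g = min (u t $ i - lo $ i) (hi $ i - u t $ i)"
        have "0 < g" using elim False by (auto simp: g_def)
        then have "\<forall>\<^sub>F k in sequentially. 1 / real (Suc k) < g"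
          using order_tendstoD(2)[OF LIMSEQ_inverse_real_of_nat] by (simp add: inverse_eq_divide)
        then show ?thesis by eventually_elim (auto simp: g_def)
      qed auto
    qed
    then show ?case by eventually_elim (auto simp: v_def E_def)
  qed
  have vb: "AE t in ?M. \<forall>k. norm (v k t) \<le> B"
    using B(2) by eventually_elim (use B(1) in \<open>auto simp: v_def\<close>)
  obtain C where C: "0 \<le> C" and sol: "\<And>p c. continuous_on {0..T} p \<Longrightarrow> (\<And>t. t \<in> {0..T} \<Longrightarrow> norm (p t) \<le> c) \<Longrightarrow>
      \<exists>y. continuous_on {0..T} y \<and>
          (\<forall>t\<in>{0..T}. norm (y t) \<le> C * c \<and> y t = p t + integral {0..t} (\<lambda>s. ?A *v y s))"
    using volterra_bounded_solvability[OF matrix_vector_mul_bounded_linear[of ?A] T] by blast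
  define c where "c k = integral {0..T} (\<lambda>t. norm (G *v (v k t - w t)))" for k
  have cint: "Linfty T (\<lambda>t. norm (G *v (v k t - w t)))" for k
    using vw[of k] unfolding Linfty_def by (auto intro: borel_measurable_norm)
  \<comment> \<open>The solution \<open>y k\<close> corrects \<open>z\<close> to the state produced by the truncated control, and it tends
    to \<open>0\<close> with its datum.\<close>
  have ysol: "\<forall>k. \<exists>y. continuous_on {0..T} y \<and>
          (\<forall>t\<in>{0..T}. norm (y t) \<le> C * c k \<and> y t = integral {0..t} (\<lambda>s. G *v (v k s - w s)) + integral {0..t} (\<lambda>s. ?A *v y s))"
  proof (rule allI, rule sol)
    fix k
    show "continuous_on {0..T} (\<lambda>t. integral {0..t} (\<lambda>s. G *v (v k s - w s)))"
      using Linfty_integrals(1)[OF vw] T by (intro indefinite_integral_continuous_1) auto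
    fix t assume t: "t \<in> {0..T}"
    have "norm (integral {0..t} (\<lambda>s. G *v (v k s - w s))) \<le> integral {0..t} (\<lambda>s. norm (G *v (v k s - w s)))"
      using Linfty_integrals(1)[OF vw t] Linfty_integrals(1)[OF cint t] by (intro integral_norm_bound_integral) auto
    also have "\<dots> \<le> c k" unfolding c_def
      using Linfty_integrals(1)[OF cint t] Linfty_integrals(1)[OF cint, of T] t by (intro integral_subset_le) auto
    finally show "norm (integral {0..t} (\<lambda>s. G *v (v k s - w s))) \<le> c k" .
  qed
  obtain y where y: "\<And>k. continuous_on {0..T} (y k) \<and>
      (\<forall>t\<in>{0..T}. norm (y k t) \<le> C * c k \<and>
        y k t = integral {0..t} (\<lambda>s. G *v (v k s - w s)) + integral {0..t} (\<lambda>s. ?A *v y k s))"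
    using choice[OF ysol] by blast
  then have yc: "\<And>k. continuous_on {0..T} (y k)"
    and yb: "\<And>k t. t \<in> {0..T} \<Longrightarrow> norm (y k t) \<le> C * c k"
    and ye: "\<And>k t. t \<in> {0..T} \<Longrightarrow> y k t = integral {0..t} (\<lambda>s. G *v (v k s - w s)) + integral {0..t} (\<lambda>s. ?A *v y k s)"
    by blast+
  have c_lim: "c \<longlonglongrightarrow> 0"
  proof -
    have "(\<lambda>k. LINT t|?M. norm (G *v (v k t - w t))) \<longlonglongrightarrow> (LINT t|?M. 0)"
    proof (rule integral_dominated_convergence[where w = "\<lambda>_. onorm ((*v) G) * (B + B)"])
      show "AE t in ?M. (\<lambda>k. norm (G *v (v k t - w t))) \<longlonglongrightarrow> 0"
        using conv
      proof eventually_elim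
        case (elim t)
        then have "\<forall>\<^sub>F k in sequentially. norm (G *v (v k t - w t)) = 0" by eventually_elim simp
        then show ?case by (rule tendsto_eventually)
      qed
      show "AE t in ?M. norm (norm (G *v (v k t - w t))) \<le> onorm ((*v) G) * (B + B)" for k
        using vb B(2)
      proof eventually_elim
        case (elim t)
        have "norm (G *v (v k t - w t)) \<le> onorm ((*v) G) * norm (v k t - w t)"
          by (rule onorm[OF matrix_vector_mul_bounded_linear])
        also have "\<dots> \<le> onorm ((*v) G) * (B + B)"
          using elim by (intro mult_left_mono onorm_pos_le matrix_vector_mul_bounded_linear)
             (metis add_mono norm_triangle_ineq4 order_trans)
        finally show ?case by simp
      qed
      show "integrable ?M (\<lambda>_. onorm ((*v) G) * (B + B))"
        by (rule Linfty_integrable[OF Linfty_continuous]) simp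
      show "(\<lambda>t. norm (G *v (v k t - w t))) \<in> borel_measurable ?M" for k
        using cint unfolding Linfty_def by blast
    qed auto
    then show ?thesis unfolding c_def using Linfty_integrals(2)[OF cint, of T] T by simp
  qed
  define zk where "zk k t = z t + y k t" for k t
  have zkc: "continuous_on {0..T} (zk k)" for k
    unfolding zk_def by (intro continuous_intros zc yc)
  have zkt: "state_trajectory T J R Q G 0 (v k) (zk k)" for k
    unfolding state_trajectory_iff_integral_equation[OF v]
  proof (intro conjI ballI zkc)
    have i: "(\<lambda>s. ?A *v z s + G *v w s) integrable_on {0..t}" "(\<lambda>s. G *v (v k s - w s)) integrable_on {0..t}"
        "(\<lambda>s. ?A *v y k s) integrable_on {0..t}" if "t \<in> {0..T}" for t
      by (intro Linfty_integrals(1)[OF _ that] Linfty_add vw w Linfty_bounded_linear[OF Linfty_continuous[OF zc]]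
          Linfty_bounded_linear[OF Linfty_continuous[OF yc]]
          Linfty_bounded_linear[OF w] matrix_vector_mul_bounded_linear)+
    show e: "zk k t = 0 + integral {0..t} (\<lambda>s. ?A *v zk k s + G *v v k s)" if t: "t \<in> {0..T}" for t
    proof -
      have "zk k t = integral {0..t} (\<lambda>s. (?A *v z s + G *v w s) + (G *v (v k s - w s) + ?A *v y k s))"
        unfolding zk_def using ze[OF t] ye[OF t, of k] i[OF t] by (simp add: integral_add integrable_add)
      then show ?thesis
        by (simp add: zk_def matrix_vector_right_distrib matrix_vector_mult_diff_distrib algebra_simps)
    qed
    show "zk k 0 = 0" using e[of 0] T by simp
  qed
  have pos: "0 \<le> cost Q G Y N 0 (v k) (zk k) T" for k
  proof (rule second_variation_nonneg_uniform[OF T opt v zkt])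
    \<comment> \<open>This step length moves the control by at most \<open>1 / (k + 1)\<close>, its distance to the bounds on \<open>E k\<close>.\<close>
    show "0 < 1 / (real (Suc k) * (B + 1))" using B(1) by simp
    show "AE t in ?M. \<forall>i. lo $ i + 1 / (real (Suc k) * (B + 1)) * \<bar>v k t $ i\<bar> \<le> u t $ i
          \<and> u t $ i + 1 / (real (Suc k) * (B + 1)) * \<bar>v k t $ i\<bar> \<le> hi $ i"
      using vb uadm
    proof eventually_elim
      case (elim t)
      show ?case
      proof
        fix i
        have "\<bar>v k t $ i\<bar> \<le> B + 1" using elim(1) component_le_norm_cart[of "v k t" i] by (smt (verit))
        then have "1 / (real (Suc k) * (B + 1)) * \<bar>v k t $ i\<bar> \<le> 1 / (real (Suc k) * (B + 1)) * (B + 1)"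
          using B(1) by (intro mult_left_mono) auto
        also have "\<dots> = 1 / real (Suc k)"
            using B(1) by (simp add: add_nonneg_eq_0_iff del: of_nat_Suc)
        finally have le: "1 / (real (Suc k) * (B + 1)) * \<bar>v k t $ i\<bar> \<le> 1 / real (Suc k)" .
        show "lo $ i + 1 / (real (Suc k) * (B + 1)) * \<bar>v k t $ i\<bar> \<le> u t $ i
          \<and> u t $ i + 1 / (real (Suc k) * (B + 1)) * \<bar>v k t $ i\<bar> \<le> hi $ i"
        proof (cases "v k t $ i = 0")
          case True then show ?thesis using elim(2) by simp
        next
          case False
          then have "lo $ i + 1 / real (Suc k) \<le> u t $ i" "u t $ i + 1 / real (Suc k) \<le> hi $ i"
            by (auto simp: v_def E_def split: if_splits)
          then show ?thesis using le by linarith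
        qed
      qed
    qed
  qed
  have lim: "(\<lambda>k. cost Q G Y N 0 (v k) (zk k) T) \<longlonglongrightarrow> cost Q G Y N 0 w z T"
  proof -
    obtain Z where Z: "\<And>t. t \<in> {0..T} \<Longrightarrow> norm (z t) \<le> Z"
      using compact_imp_bounded[OF compact_continuous_image[OF zc compact_Icc]] unfolding bounded_iff by blast
    obtain D where D: "\<And>k. norm (c k) \<le> D"
      using convergent_imp_Bseq[of c] c_lim unfolding convergent_def Bseq_def by blast
    have zkb: "norm (zk k t) \<le> Z + C * D" if "t \<in> {0..T}" for k t
    proof -
      have "norm (zk k t) \<le> norm (z t) + norm (y k t)" unfolding zk_def by (rule norm_triangle_ineq)
      also have "\<dots> \<le> Z + C * D"
        using Z[OF that] yb[OF that, of k] D[of k] C by (smt (verit) mult_left_mono real_norm_def)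
      finally show ?thesis .
    qed
    have Z0: "0 \<le> Z + C * D" using zkb[of 0] T by (meson atLeastAtMost_iff norm_ge_zero order_refl order_trans)
    let ?H = "transpose G ** Q"
    define a where "a = onorm ((*v) ?H)"
    define b where "b = onorm ((*v) Y)"
    define n where "n = onorm ((*v) N)"
    have a: "0 \<le> a" "\<And>s. norm (?H *v s) \<le> a * norm s" and b: "0 \<le> b" "\<And>s. norm (Y *v s) \<le> b * norm s"
      and n: "0 \<le> n" "\<And>s. norm (N *v s) \<le> n * norm s"
      unfolding a_def b_def n_def by (auto intro: onorm onorm_pos_le)
    define S where "S = Z + C * D"
    have rb: "norm (running_cost Q G Y N 0 s r) \<le> a * S * (b * (a * S)) + a * S * (n * B)"
      if "norm s \<le> S" "norm r \<le> B" for s r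
    proof -
      have hs: "norm (?H *v s) \<le> a * S" by (rule order_trans[OF a(2) mult_left_mono[OF that(1) a(1)]])
      have "norm (Y *v (?H *v s)) \<le> b * (a * S)" by (rule order_trans[OF b(2) mult_left_mono[OF hs b(1)]])
      with hs have 1: "\<bar>(?H *v s) \<bullet> (Y *v (?H *v s))\<bar> \<le> a * S * (b * (a * S))"
        by (intro order_trans[OF Cauchy_Schwarz_ineq2] mult_mono) (use norm_ge_zero order_trans in blast)+
      have "norm (N *v r) \<le> n * B" by (rule order_trans[OF n(2) mult_left_mono[OF that(2) n(1)]])
      with hs have 2: "\<bar>(?H *v s) \<bullet> (N *v r)\<bar> \<le> a * S * (n * B)"
        by (intro order_trans[OF Cauchy_Schwarz_ineq2] mult_mono) (use norm_ge_zero order_trans in blast)+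
      show ?thesis using 1 2 unfolding running_cost_def Let_def by simp
    qed
    have "(\<lambda>k. LINT t|?M. running_cost Q G Y N 0 (zk k t) (v k t)) \<longlonglongrightarrow> (LINT t|?M. running_cost Q G Y N 0 (z t) (w t))"
    proof (rule integral_dominated_convergence[where w = "\<lambda>_. a * S * (b * (a * S)) + a * S * (n * B)"])
      show "AE t in ?M. (\<lambda>k. running_cost Q G Y N 0 (zk k t) (v k t)) \<longlonglongrightarrow> running_cost Q G Y N 0 (z t) (w t)"
        using conv AE_space
      proof eventually_elim
        case (elim t)
        have "(\<lambda>k. C * c k) \<longlonglongrightarrow> 0" using tendsto_mult_right_zero[OF c_lim] .
        then have "(\<lambda>k. y k t) \<longlonglongrightarrow> 0"
          by (rule Lim_null_comparison[rotated]) (use yb elim in auto)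
        from tendsto_add[OF tendsto_const this] have "(\<lambda>k. zk k t) \<longlonglongrightarrow> z t" by (simp add: zk_def)
        moreover have "(\<lambda>k. v k t) \<longlonglongrightarrow> w t" using elim(1) by (rule tendsto_eventually)
        ultimately show ?case unfolding running_cost_def Let_def
          by (intro tendsto_intros bounded_linear.tendsto[OF matrix_vector_mul_bounded_linear])
      qed
      show "AE t in ?M. norm (running_cost Q G Y N 0 (zk k t) (v k t)) \<le> a * S * (b * (a * S)) + a * S * (n * B)" for k
        using vb AE_space by eventually_elim (use rb zkb S_def in auto)
      show "integrable ?M (\<lambda>_. a * S * (b * (a * S)) + a * S * (n * B))"
        by (rule Linfty_integrable[OF Linfty_continuous]) simp
    qed (use Linfty_running_cost[OF zkc v] Linfty_running_cost[OF zc w] in \<open>auto simp: Linfty_def\<close>)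
    then show ?thesis unfolding cost_def .
  qed
  show ?thesis by (rule LIMSEQ_le_const[OF lim]) (use pos in auto)
qed

section \<open>Expansion along primitives of control variations\<close>

lemma matrix_inner_bound:
  fixes M :: "real^'a^'c" and M' :: "real^'b^'c"
  obtains k where "0 \<le> k" "\<And>x y. \<bar>(M *v x) \<bullet> (M' *v y)\<bar> \<le> k * (norm x * norm y)"
proof
  show "0 \<le> onorm ((*v) M) * onorm ((*v) M')"
    by (intro mult_nonneg_nonneg onorm_pos_le matrix_vector_mul_bounded_linear)
  show "\<bar>(M *v x) \<bullet> (M' *v y)\<bar> \<le> onorm ((*v) M) * onorm ((*v) M') * (norm x * norm y)" for x y
  proof -
    have "\<bar>(M *v x) \<bullet> (M' *v y)\<bar> \<le> (onorm ((*v) M) * norm x) * (onorm ((*v) M') * norm y)"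
      by (intro order_trans[OF Cauchy_Schwarz_ineq2] mult_mono onorm mult_nonneg_nonneg onorm_pos_le
          matrix_vector_mul_bounded_linear norm_ge_zero)
    then show ?thesis by (simp add: mult_ac)
  qed
qed

text \<open>
  Up to the factor \<open>-2\<close> and for symmetric \<open>Q\<close>, this is the quadratic form of the matrix in the generalized
  Legendre-Clebsch condition.
\<close>

definition legendre_clebsch_form :: "real^'n^'n \<Rightarrow> real^'n^'n \<Rightarrow> real^'m^'n \<Rightarrow> real^'m^'m \<Rightarrow> real^'m^'m \<Rightarrow> real^'m \<Rightarrow> real" where
  "legendre_clebsch_form A Q G Y N v =
     (let H = transpose G ** Q in
      (H *v (G *v v)) \<bullet> (Y *v (H *v (G *v v))) - (H *v (A *v (G *v v))) \<bullet> (N *v v))"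

text \<open>
  This is Goh's transformation: the primitive \<open>W\<close> of the control variation \<open>w\<close> becomes the new control.
  The state splits into \<open>z = G W + e\<close> with \<open>e' = A z\<close>, so that \<open>e\<close> is driven by \<open>W\<close> and not by its
  derivative, and its size is bounded by the integral of \<open>norm W\<close>. Integrating the product of \<open>e\<close> and
  \<open>w\<close> by parts removes \<open>w\<close> from all terms of the cost but the first one in the estimate. The terms that
  contain \<open>e\<close> are products of at least two small factors and go into the remainder.
\<close>

lemma second_variation_expansion:
  fixes J R Q :: "real^'n^'n" and G :: "real^'m^'n" and Y N :: "real^'m^'m"
  assumes T: "0 \<le> T"
  obtains K where "\<And>W w S. \<lbrakk>continuous_on {0..T} W; finite S;
          \<And>t. t \<in> {0<..<T} - S \<Longrightarrow> (W has_vector_derivative w t) (at t);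
          W 0 = 0; W T = 0; Linfty T w\<rbrakk> \<Longrightarrow>
       \<exists>z. state_trajectory T J R Q G 0 w z \<and>
         cost Q G Y N 0 w z T
           \<le> integral {0..T} (\<lambda>t. ((transpose G ** Q) *v (G *v W t)) \<bullet> (N *v w t))
             + integral {0..T} (\<lambda>t. legendre_clebsch_form ((J - R) ** Q) Q G Y N (W t))
             + K * (integral {0..T} (\<lambda>t. norm (W t)))\<^sup>2"
proof -
  let ?A = "(J - R) ** Q" and ?H = "transpose G ** Q"
  obtain C where C: "0 \<le> C" and sol: "\<And>p c. continuous_on {0..T} p \<Longrightarrow> (\<And>t. t \<in> {0..T} \<Longrightarrow> norm (p t) \<le> c) \<Longrightarrow>
      \<exists>y. continuous_on {0..T} y \<and>
          (\<forall>t\<in>{0..T}. norm (y t) \<le> C * c \<and> y t = p t + integral {0..t} (\<lambda>s. ?A *v y s))"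
    using volterra_bounded_solvability[OF matrix_vector_mul_bounded_linear[of ?A] T] by blast
  define k1 where "k1 = onorm ((*v) (?A ** G))"
  have k1: "0 \<le> k1" "\<And>x. norm (?A *v (G *v x)) \<le> k1 * norm x"
    using onorm[OF matrix_vector_mul_bounded_linear, of "?A ** G"]
    by (auto simp: k1_def onorm_pos_le matrix_vector_mul_assoc)
  obtain a1 where a1: "0 \<le> a1" "\<And>x y. \<bar>((?H ** G) *v x) \<bullet> ((Y ** ?H) *v y)\<bar> \<le> a1 * (norm x * norm y)"
    using matrix_inner_bound by blast
  obtain a2 where a2: "0 \<le> a2" "\<And>x y. \<bar>(?H *v x) \<bullet> ((Y ** ?H ** G) *v y)\<bar> \<le> a2 * (norm x * norm y)"
    using matrix_inner_bound by blast
  obtain a3 where a3: "0 \<le> a3" "\<And>x y. \<bar>(?H *v x) \<bullet> ((Y ** ?H) *v y)\<bar> \<le> a3 * (norm x * norm y)"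
    using matrix_inner_bound by blast
  obtain a4 where a4: "0 \<le> a4" "\<And>x y. \<bar>((?H ** ?A) *v x) \<bullet> (N *v y)\<bar> \<le> a4 * (norm x * norm y)"
    using matrix_inner_bound by blast
  define K where "K = (a1 + a2 + a4) * (C * k1) + T * (a3 * (C * k1)\<^sup>2)"
  have main: "\<exists>z. state_trajectory T J R Q G 0 w z \<and>
         cost Q G Y N 0 w z T
           \<le> integral {0..T} (\<lambda>t. (?H *v (G *v W t)) \<bullet> (N *v w t))
             + integral {0..T} (\<lambda>t. legendre_clebsch_form ?A Q G Y N (W t))
             + K * (integral {0..T} (\<lambda>t. norm (W t)))\<^sup>2"
    if W: "continuous_on {0..T} W" and S: "finite S"
      and der: "\<And>t. t \<in> {0<..<T} - S \<Longrightarrow> (W has_vector_derivative w t) (at t)"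
      and W0: "W 0 = 0" and WT: "W T = 0" and w: "Linfty T w" for W w S
  proof -
    note cmv = bounded_linear.continuous_on[OF matrix_vector_mul_bounded_linear]
    define r where "r = integral {0..T} (\<lambda>t. norm (W t))"
    have nWi: "(\<lambda>t. norm (W t)) integrable_on {0..t}" if "t \<in> {0..T}" for t
      using that by (intro integrable_continuous_real continuous_intros continuous_on_subset[OF W]) auto
    have r0: "0 \<le> r" unfolding r_def using nWi T by (intro integral_nonneg) auto
    have ci: "f integrable_on {0..t}" if "continuous_on {0..T} f" "t \<in> {0..T}" for f :: "real \<Rightarrow> 'z::euclidean_space" and t
      using that by (intro integrable_continuous_real continuous_on_subset[OF that(1)]) auto
    have AGW: "continuous_on {0..T} (\<lambda>t. ?A *v (G *v W t))"
      by (intro cmv W)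
    have "\<exists>e. continuous_on {0..T} e \<and>
        (\<forall>t\<in>{0..T}. norm (e t) \<le> C * (k1 * r) \<and>
           e t = integral {0..t} (\<lambda>s. ?A *v (G *v W s)) + integral {0..t} (\<lambda>s. ?A *v e s))"
    proof (rule sol)
      show "continuous_on {0..T} (\<lambda>t. integral {0..t} (\<lambda>s. ?A *v (G *v W s)))"
        using ci[OF AGW, of T] T by (intro indefinite_integral_continuous_1) auto
      fix t assume t: "t \<in> {0..T}"
      have "norm (integral {0..t} (\<lambda>s. ?A *v (G *v W s))) \<le> integral {0..t} (\<lambda>s. k1 * norm (W s))"
        using ci[OF AGW t] nWi[OF t] k1(2) by (intro integral_norm_bound_integral integrable_on_mult_right) auto
      also have "\<dots> = k1 * integral {0..t} (\<lambda>s. norm (W s))" by simp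
      also have "\<dots> \<le> k1 * r" unfolding r_def
        using nWi[OF t] nWi[of T] t by (intro mult_left_mono k1 integral_subset_le) auto
      finally show "norm (integral {0..t} (\<lambda>s. ?A *v (G *v W s))) \<le> k1 * r" .
    qed
    then obtain e where e: "continuous_on {0..T} e"
      and eb: "\<And>t. t \<in> {0..T} \<Longrightarrow> norm (e t) \<le> C * (k1 * r)"
      and ee: "\<And>t. t \<in> {0..T} \<Longrightarrow> e t = integral {0..t} (\<lambda>s. ?A *v (G *v W s)) + integral {0..t} (\<lambda>s. ?A *v e s)"
      by blast
    define z where "z t = G *v W t + e t" for t
    have z: "continuous_on {0..T} z" unfolding z_def by (intro continuous_intros cmv W e)
    have Az: "continuous_on {0..T} (\<lambda>t. ?A *v z t)" by (intro cmv z)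
    have Ae: "continuous_on {0..T} (\<lambda>t. ?A *v e t)" by (intro cmv e)
    have ez: "e t = integral {0..t} (\<lambda>s. ?A *v z s)" if t: "t \<in> {0..T}" for t
      unfolding ee[OF t] z_def matrix_vector_right_distrib
      using ci[OF AGW t] ci[OF Ae t] by (simp add: integral_add)
    have Gw: "((\<lambda>s. G *v w s) has_integral G *v W t) {0..t}" if t: "t \<in> {0..T}" for t
    proof -
      have "(w has_integral (W t - W 0)) {0..t}"
        by (rule fundamental_theorem_of_calculus_interior_strong[OF S])
           (use t der in \<open>auto intro: continuous_on_subset[OF W]\<close>)
      from has_integral_linear[OF this matrix_vector_mul_bounded_linear[of G]] show ?thesis
        by (simp add: W0 o_def)
    qed
    have traj: "state_trajectory T J R Q G 0 w z"
      unfolding state_trajectory_iff_integral_equation[OF w]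
    proof (intro conjI ballI z)
      show zt: "z t = 0 + integral {0..t} (\<lambda>s. ?A *v z s + G *v w s)" if t: "t \<in> {0..T}" for t
        using ez[OF t] Gw[OF t] ci[OF Az t] unfolding z_def[of t]
        by (simp add: integral_add has_integral_iff)
      show "z 0 = 0" using zt[of 0] T by simp
    qed
    \<comment> \<open>Integration by parts moves the derivative from \<open>W\<close> to \<open>e\<close>; there are no boundary terms because
      \<open>W\<close> vanishes at both ends.\<close>
    have parts: "((\<lambda>t. (?H *v (?A *v z t)) \<bullet> (N *v W t) + (?H *v e t) \<bullet> (N *v w t)) has_integral 0) {0..T}"
    proof -
      have "((\<lambda>t. (?H *v (?A *v z t)) \<bullet> (N *v W t) + (?H *v e t) \<bullet> (N *v w t)) has_integral
          ((?H *v e T) \<bullet> (N *v W T) - (?H *v e 0) \<bullet> (N *v W 0))) {0..T}"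
      proof (rule fundamental_theorem_of_calculus_interior_strong[OF S T])
        show "continuous_on {0..T} (\<lambda>t. (?H *v e t) \<bullet> (N *v W t))"
          by (intro continuous_intros cmv e W)
        fix t assume t: "t \<in> {0<..<T} - S"
        then have tT: "t \<in> {0..T}" "t \<in> {0<..<T}" by auto
        have "((\<lambda>s. integral {0..s} (\<lambda>s. ?A *v z s)) has_vector_derivative ?A *v z t) (at t within {0..T})"
          by (rule integral_has_vector_derivative[OF Az tT(1)])
        then have "((\<lambda>s. integral {0..s} (\<lambda>s. ?A *v z s)) has_vector_derivative ?A *v z t) (at t)"
          using tT(2) by (simp add: at_within_Icc_at)
        then have "(e has_vector_derivative ?A *v z t) (at t)"
          by (rule has_vector_derivative_transform_within_open[OF _ open_greaterThanLessThan tT(2)])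
             (use ez in auto)
        then have 1: "((\<lambda>t. ?H *v e t) has_vector_derivative ?H *v (?A *v z t)) (at t)"
          by (rule bounded_linear.has_vector_derivative[OF matrix_vector_mul_bounded_linear])
        have 2: "((\<lambda>t. N *v W t) has_vector_derivative N *v w t) (at t)"
          by (rule bounded_linear.has_vector_derivative[OF matrix_vector_mul_bounded_linear der[OF t]])
        show "((\<lambda>t. (?H *v e t) \<bullet> (N *v W t)) has_vector_derivative
            (?H *v (?A *v z t)) \<bullet> (N *v W t) + (?H *v e t) \<bullet> (N *v w t)) (at t)"
          using bounded_bilinear.has_vector_derivative[OF bounded_bilinear_inner 1 2] by (simp add: add.commute)
      qed
      then show ?thesis by (simp add: W0 WT)
    qed
    define m where "m t = (?H *v (G *v W t)) \<bullet> (N *v w t)" for t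
    have "Linfty T m" unfolding m_def
      by (intro Linfty_inner Linfty_bounded_linear[OF w] Linfty_continuous cmv W matrix_vector_mul_bounded_linear)
    then have mi: "m integrable_on {0..T}" using Linfty_integrals(1) T by auto
    have li: "(\<lambda>t. legendre_clebsch_form ?A Q G Y N (W t)) integrable_on {0..T}"
      unfolding legendre_clebsch_form_def Let_def by (intro integrable_continuous_real continuous_intros cmv W)
    have ri: "(\<lambda>t. running_cost Q G Y N 0 (z t) (w t)) integrable_on {0..T}"
      using Linfty_integrals(1)[OF Linfty_running_cost[OF z w]] T by simp
    have "cost Q G Y N 0 w z T = integral {0..T} (\<lambda>t. running_cost Q G Y N 0 (z t) (w t)
        - ((?H *v (?A *v z t)) \<bullet> (N *v W t) + (?H *v e t) \<bullet> (N *v w t)))"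
      unfolding cost_eq_integral[OF z w T] using parts ri
      by (subst integral_diff) (auto simp: has_integral_iff)
    also have "\<dots> \<le> integral {0..T} (\<lambda>t. m t + legendre_clebsch_form ?A Q G Y N (W t)
        + ((a1 + a2 + a4) * (C * (k1 * r)) * norm (W t) + a3 * (C * (k1 * r))\<^sup>2))"
    proof (rule integral_le)
      show "(\<lambda>t. running_cost Q G Y N 0 (z t) (w t)
        - ((?H *v (?A *v z t)) \<bullet> (N *v W t) + (?H *v e t) \<bullet> (N *v w t))) integrable_on {0..T}"
        using parts ri by (intro integrable_diff) (auto simp: has_integral_iff)
      show "(\<lambda>t. m t + legendre_clebsch_form ?A Q G Y N (W t)
        + ((a1 + a2 + a4) * (C * (k1 * r)) * norm (W t) + a3 * (C * (k1 * r))\<^sup>2)) integrable_on {0..T}"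
        using T by (intro integrable_add mi li integrable_on_mult_right nWi integrable_const_ivl) auto
      fix t assume t: "t \<in> {0..T}"
      let ?W = "W t" and ?e = "e t" and ?c = "C * (k1 * r)"
      have "running_cost Q G Y N 0 (z t) (w t)
          - ((?H *v (?A *v z t)) \<bullet> (N *v ?W) + (?H *v ?e) \<bullet> (N *v w t))
        = m t + legendre_clebsch_form ?A Q G Y N ?W
          + (((?H ** G) *v ?W) \<bullet> ((Y ** ?H) *v ?e) + (?H *v ?e) \<bullet> ((Y ** ?H ** G) *v ?W)
             + (?H *v ?e) \<bullet> ((Y ** ?H) *v ?e) - ((?H ** ?A) *v ?e) \<bullet> (N *v ?W))"
        unfolding running_cost_def legendre_clebsch_form_def Let_def m_def z_def
        by (simp add: matrix_vector_right_distrib inner_add_left inner_add_right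
            matrix_vector_mul_assoc[symmetric])
      also have "\<dots> \<le> m t + legendre_clebsch_form ?A Q G Y N ?W
          + (a1 * (norm ?W * norm ?e) + a2 * (norm ?e * norm ?W) + a3 * (norm ?e * norm ?e) + a4 * (norm ?e * norm ?W))"
        using a1(2)[of ?W ?e] a2(2)[of ?e ?W] a3(2)[of ?e ?e] a4(2)[of ?e ?W] by linarith
      also have "\<dots> = m t + legendre_clebsch_form ?A Q G Y N ?W
          + ((a1 + a2 + a4) * norm ?e * norm ?W + a3 * (norm ?e)\<^sup>2)"
        by (simp add: algebra_simps power2_eq_square)
      also have "\<dots> \<le> m t + legendre_clebsch_form ?A Q G Y N ?W + ((a1 + a2 + a4) * ?c * norm ?W + a3 * ?c\<^sup>2)"
        using eb[OF t] a1(1) a2(1) a3(1) a4(1) C k1(1) r0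
        by (intro add_mono mult_mono power_mono order_refl mult_nonneg_nonneg) auto
      finally show "running_cost Q G Y N 0 (z t) (w t)
          - ((?H *v (?A *v z t)) \<bullet> (N *v ?W) + (?H *v ?e) \<bullet> (N *v w t))
        \<le> m t + legendre_clebsch_form ?A Q G Y N ?W + ((a1 + a2 + a4) * ?c * norm ?W + a3 * ?c\<^sup>2)" .
    qed
    also have "\<dots> = integral {0..T} m + integral {0..T} (\<lambda>t. legendre_clebsch_form ?A Q G Y N (W t))
        + ((a1 + a2 + a4) * (C * (k1 * r)) * r + T * (a3 * (C * (k1 * r))\<^sup>2))"
    proof -
      have n: "((\<lambda>t. norm (W t)) has_integral r) {0..T}"
        unfolding r_def by (rule integrable_integral) (use nWi T in auto)
      have c: "((\<lambda>t. a3 * (C * (k1 * r))\<^sup>2) has_integral T * (a3 * (C * (k1 * r))\<^sup>2)) {0..T}"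
        using has_integral_const_real[of "a3 * (C * (k1 * r))\<^sup>2" 0 T] T by simp
      have "((\<lambda>t. m t + legendre_clebsch_form ?A Q G Y N (W t)
        + ((a1 + a2 + a4) * (C * (k1 * r)) * norm (W t) + a3 * (C * (k1 * r))\<^sup>2)) has_integral
          integral {0..T} m + integral {0..T} (\<lambda>t. legendre_clebsch_form ?A Q G Y N (W t))
        + ((a1 + a2 + a4) * (C * (k1 * r)) * r + T * (a3 * (C * (k1 * r))\<^sup>2))) {0..T}"
        by (intro has_integral_add has_integral_mult_right n c integrable_integral mi li)
      then show ?thesis by (rule integral_unique)
    qed
    also have "(a1 + a2 + a4) * (C * (k1 * r)) * r + T * (a3 * (C * (k1 * r))\<^sup>2) = K * r\<^sup>2"
      unfolding K_def by (simp add: algebra_simps power2_eq_square)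
    finally have "cost Q G Y N 0 w z T \<le> integral {0..T} m + integral {0..T} (\<lambda>t. legendre_clebsch_form ?A Q G Y N (W t)) + K * r\<^sup>2" .
    then show ?thesis unfolding m_def r_def using traj by (intro exI conjI)
  qed
  show ?thesis by (rule that) (rule main)
qed

section \<open>Loops that shrink in time\<close>

lemma rescaled_integral:
  fixes g :: "real \<Rightarrow> 'a::euclidean_space"
  assumes g: "continuous_on {0..1} g" and h: "0 < h" and a: "0 \<le> a" "a + h \<le> T"
  shows "((\<lambda>t. if t \<in> {a<..<a+h} then g ((t - a) / h) else 0) has_integral (h *\<^sub>R integral {0..1} g)) {0..T}"
proof -
  have "(g has_integral integral {0..1} g) (cbox 0 1)"
    using integrable_integral[OF integrable_continuous_real[OF g]] by simp
  from has_integral_affinity'[OF this, of "1 / h" "- a / h"] h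
  have *: "((\<lambda>t. g ((1 / h) *\<^sub>R t + - a / h)) has_integral (integral {0..1} g /\<^sub>R (1 / h) ^ DIM(real)))
      (cbox ((0 - - a / h) /\<^sub>R (1 / h)) ((1 - - a / h) /\<^sub>R (1 / h)))" by simp
  have "(0 - - a / h) /\<^sub>R (1 / h) = a" "(1 - - a / h) /\<^sub>R (1 / h) = a + h"
    using h by (simp_all add: field_simps)
  moreover have "(1 / h) *\<^sub>R t + - a / h = (t - a) / h" for t by (simp add: diff_divide_distrib)
  moreover have "integral {0..1} g /\<^sub>R (1 / h) ^ DIM(real) = h *\<^sub>R integral {0..1} g" by simp
  ultimately have "((\<lambda>t. g ((t - a) / h)) has_integral (h *\<^sub>R integral {0..1} g)) {a..a+h}"
    using * by (simp only: interval_cbox)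
  then have "((\<lambda>t. if t \<in> {a..a+h} then g ((t - a) / h) else 0) has_integral (h *\<^sub>R integral {0..1} g)) {0..T}"
    using a by (subst has_integral_restrict) auto
  then show ?thesis
    by (rule has_integral_spike_finite[of "{a, a+h}", rotated 2]) auto
qed

lemma nonneg_expansion_coefficients:
  fixes \<alpha> \<beta> \<gamma> d :: real
  assumes d: "0 < d" and nonneg: "\<And>h. 0 < h \<Longrightarrow> h \<le> d \<Longrightarrow> 0 \<le> \<alpha> + h * \<beta> + h\<^sup>2 * \<gamma>"
  shows "0 \<le> \<alpha>" and "\<alpha> = 0 \<Longrightarrow> 0 \<le> \<beta>"
proof -
  have ev: "\<forall>\<^sub>F h in at_right 0. 0 < h \<and> h \<le> d"
    using d by (auto simp: eventually_at_right_field intro!: exI[of _ d])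
  have lim: "((\<lambda>h. \<alpha> + h * \<beta> + h\<^sup>2 * \<gamma>) \<longlongrightarrow> \<alpha> + 0 * \<beta> + 0\<^sup>2 * \<gamma>) (at_right 0)"
    by (intro tendsto_intros)
  have "\<forall>\<^sub>F h in at_right 0. 0 \<le> \<alpha> + h * \<beta> + h\<^sup>2 * \<gamma>"
    using ev by eventually_elim (use nonneg in auto)
  from tendsto_lowerbound[OF lim this] show "0 \<le> \<alpha>" by simp
  assume 0: "\<alpha> = 0"
  have ev': "\<forall>\<^sub>F h in at_right 0. 0 \<le> \<beta> + h * \<gamma>"
    using ev
  proof eventually_elim
    case (elim h)
    then have "0 \<le> h * (\<beta> + h * \<gamma>)" using nonneg[of h] 0 by (simp add: algebra_simps power2_eq_square)
    then show ?case using elim by (simp add: zero_le_mult_iff)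
  qed
  have lim': "((\<lambda>h. \<beta> + h * \<gamma>) \<longlongrightarrow> \<beta> + 0 * \<gamma>) (at_right 0)"
    by (intro tendsto_intros)
  from tendsto_lowerbound[OF lim' ev'] show "0 \<le> \<beta>" by simp
qed

lemma legendre_clebsch_form_scaleR: "legendre_clebsch_form A Q G Y N (c *\<^sub>R v) = c\<^sup>2 * legendre_clebsch_form A Q G Y N v"
  unfolding legendre_clebsch_form_def Let_def
  by (simp add: matrix_vector_mult_scaleR power2_eq_square algebra_simps)

text \<open>
  A loop \<open>F\<close> is run through on the interval \<open>(a, a + h)\<close> and its speed is the control variation. In the
  expansion of the second variation, the first term depends only on the shape of the loop and not on
  the time taken, the Legendre-Clebsch term scales with \<open>h\<close> and the remainder with \<open>h\<^sup>2\<close>. Letting \<open>h\<close>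
  tend to \<open>0\<close>, the signs of the first two terms can be read off in turn.
\<close>

lemma shrinking_loop_conditions:
  fixes F F' :: "real \<Rightarrow> real^'m" and J R Q :: "real^'n^'n"
  assumes opt: "optimal_control T J R Q G Y N l lo hi x0 u x"
    and ab: "0 \<le> a" "a < b" "b \<le> T"
    and interior: "AE t in lebesgue_on {a<..<b}. \<forall>i\<in>I. lo $ i < u t $ i \<and> u t $ i < hi $ i"
    and der: "\<And>s. (F has_vector_derivative F' s) (at s)"
    and F': "continuous_on UNIV F'"
    and F01: "F 0 = 0" "F 1 = 0"
    and supp: "\<And>s i. i \<notin> I \<Longrightarrow> F' s $ i = 0"
  defines "\<alpha> \<equiv> integral {0..1} (\<lambda>s. ((transpose G ** Q) *v (G *v F s)) \<bullet> (N *v F' s))"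
    and "\<beta> \<equiv> integral {0..1} (\<lambda>s. legendre_clebsch_form ((J - R) ** Q) Q G Y N (F s))"
  shows "0 \<le> \<alpha>" and "\<alpha> = 0 \<Longrightarrow> 0 \<le> \<beta>"
proof -
  let ?H = "transpose G ** Q" and ?A = "(J - R) ** Q"
  have T: "0 \<le> T" using ab by simp
  note cmv = bounded_linear.continuous_on[OF matrix_vector_mul_bounded_linear]
  have F: "continuous_on S F" for S
    by (intro continuous_at_imp_continuous_on ballI has_vector_derivative_continuous[OF der])
  have F'S: "continuous_on S F'" for S using F' by (rule continuous_on_subset) simp
  define \<rho> where "\<rho> = integral {0..1} (\<lambda>s. norm (F s))"
  obtain K where var: "\<And>W w S. \<lbrakk>continuous_on {0..T} W; finite S;
          \<And>t. t \<in> {0<..<T} - S \<Longrightarrow> (W has_vector_derivative w t) (at t);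
          W 0 = 0; W T = 0; Linfty T w\<rbrakk> \<Longrightarrow>
       \<exists>z. state_trajectory T J R Q G 0 w z \<and>
         cost Q G Y N 0 w z T
           \<le> integral {0..T} (\<lambda>t. (?H *v (G *v W t)) \<bullet> (N *v w t))
             + integral {0..T} (\<lambda>t. legendre_clebsch_form ?A Q G Y N (W t))
             + K * (integral {0..T} (\<lambda>t. norm (W t)))\<^sup>2"
  proof (rule second_variation_expansion[OF T, where J = J and R = R and Q = Q and G = G and Y = Y and N = N], goal_cases)
    case (1 K)
    show ?case by (rule 1(1)) (rule 1(2))
  qed
  have expand: "0 \<le> \<alpha> + h * \<beta> + h\<^sup>2 * (K * \<rho>\<^sup>2)" if h: "0 < h" "h \<le> b - a" for h
  proof -
    let ?I = "{a<..<a+h}"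
    have ah: "a + h \<le> T" using h ab by simp
    define W where "W t = (if t \<in> ?I then F ((t - a) / h) else 0)" for t
    define w where "w t = (if t \<in> ?I then (1 / h) *\<^sub>R F' ((t - a) / h) else 0)" for t
    \<comment> \<open>Clamping the rescaled time to \<open>[0, 1]\<close> shows continuity, as \<open>F\<close> vanishes at both ends.\<close>
    have Wclamp: "W t = F (max 0 (min 1 ((t - a) / h)))" for t
      using h(1) F01 by (auto simp: W_def max_def min_def field_simps)
    have Wc: "continuous_on {0..T} W"
      unfolding Wclamp
      by (intro continuous_on_compose2[OF F[of UNIV]] continuous_intros) (use h in auto)
    have Wder: "(W has_vector_derivative w t) (at t)" if t: "t \<in> {0<..<T} - {a, a+h}" for t
    proof (cases "t \<in> ?I")
      case True
      have "((\<lambda>t. (t - a) / h) has_vector_derivative 1 / h) (at t)"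
        using h(1) by (auto intro!: derivative_eq_intros simp: has_real_derivative_iff_has_vector_derivative[symmetric])
      from vector_diff_chain_at[OF this der]
      have "((\<lambda>t. F ((t - a) / h)) has_vector_derivative w t) (at t)"
        using True by (simp add: w_def o_def)
      then show ?thesis
        by (rule has_vector_derivative_transform_within_open[OF _ open_greaterThanLessThan True])
           (simp add: W_def)
    next
      case False
      then have t': "t \<in> - {a..a+h}" using t by auto
      have "((\<lambda>_. 0) has_vector_derivative w t) (at t)"
        using False by (simp only: w_def if_False has_vector_derivative_const)
      then show ?thesis
        by (rule has_vector_derivative_transform_within_open[OF _ _ t']) (auto simp: W_def)
    qed
    have wL: "Linfty T w"
      unfolding w_def
    proof (rule Linfty_restrict[OF Linfty_continuous])
      show "continuous_on {0..T} (\<lambda>t. (1 / h) *\<^sub>R F' ((t - a) / h))"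
        using h by (intro continuous_intros continuous_on_compose2[OF F']) auto
      have "{t \<in> {0..T}. t \<in> ?I} = {0..T} \<inter> ?I" by auto
      then show "{t \<in> {0..T}. t \<in> ?I} \<in> sets (lebesgue_on {0..T})"
        by (simp add: sets_restrict_space_iff)
    qed
    have "\<exists>z. state_trajectory T J R Q G 0 w z \<and>
         cost Q G Y N 0 w z T
           \<le> integral {0..T} (\<lambda>t. (?H *v (G *v W t)) \<bullet> (N *v w t))
             + integral {0..T} (\<lambda>t. legendre_clebsch_form ?A Q G Y N (W t))
             + K * (integral {0..T} (\<lambda>t. norm (W t)))\<^sup>2"
      by (rule var[OF Wc _ Wder _ _ wL, of "{a, a+h}"]) (use ab h ah in \<open>auto simp: W_def\<close>)
    then obtain z where z: "state_trajectory T J R Q G 0 w z"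
      and le: "cost Q G Y N 0 w z T
           \<le> integral {0..T} (\<lambda>t. (?H *v (G *v W t)) \<bullet> (N *v w t))
             + integral {0..T} (\<lambda>t. legendre_clebsch_form ?A Q G Y N (W t))
             + K * (integral {0..T} (\<lambda>t. norm (W t)))\<^sup>2" by blast
    have "AE t in lebesgue_on {0..T}. \<forall>i. w t $ i \<noteq> 0 \<longrightarrow> lo $ i < u t $ i \<and> u t $ i < hi $ i"
    proof -
      have "AE t in lebesgue. t \<in> {a<..<b} \<longrightarrow> (\<forall>i\<in>I. lo $ i < u t $ i \<and> u t $ i < hi $ i)"
        using interior by (simp add: AE_restrict_space_iff)
      then have "AE t in lebesgue. t \<in> {0..T} \<longrightarrow> (\<forall>i. w t $ i \<noteq> 0 \<longrightarrow> lo $ i < u t $ i \<and> u t $ i < hi $ i)"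
      proof eventually_elim
        case (elim t)
        show ?case
        proof (intro impI allI)
          fix i assume "w t $ i \<noteq> 0"
          then have "t \<in> ?I" "i \<in> I" using supp by (auto simp: w_def split: if_splits)
          then show "lo $ i < u t $ i \<and> u t $ i < hi $ i" using elim h by auto
        qed
      qed
      then show ?thesis by (simp add: AE_restrict_space_iff)
    qed
    from second_variation_nonneg[OF T opt wL z this]
    have nonneg: "0 \<le> cost Q G Y N 0 w z T" .
    note rescale = integral_unique[OF rescaled_integral[OF _ h(1) ab(1) ah]]
    have "integral {0..T} (\<lambda>t. (?H *v (G *v W t)) \<bullet> (N *v w t)) = integral {0..T}
        (\<lambda>t. if t \<in> ?I then (1 / h) * ((?H *v (G *v F ((t - a) / h))) \<bullet> (N *v F' ((t - a) / h))) else 0)"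
      by (intro integral_cong) (simp add: W_def w_def matrix_vector_mult_scaleR)
    also have "\<dots> = h *\<^sub>R integral {0..1} (\<lambda>s. (1 / h) * ((?H *v (G *v F s)) \<bullet> (N *v F' s)))"
      by (rule rescale) (intro continuous_intros cmv F F'S)
    also have "\<dots> = \<alpha>" using h(1) by (simp add: \<alpha>_def)
    finally have 1: "integral {0..T} (\<lambda>t. (?H *v (G *v W t)) \<bullet> (N *v w t)) = \<alpha>" .
    have "integral {0..T} (\<lambda>t. legendre_clebsch_form ?A Q G Y N (W t)) = integral {0..T}
        (\<lambda>t. if t \<in> ?I then legendre_clebsch_form ?A Q G Y N (F ((t - a) / h)) else 0)"
      using legendre_clebsch_form_scaleR[of ?A Q G Y N 0 0] by (intro integral_cong) (simp add: W_def)
    also have "\<dots> = h *\<^sub>R \<beta>"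
      unfolding \<beta>_def by (rule rescale) (unfold legendre_clebsch_form_def Let_def, intro continuous_intros cmv F)
    finally have 2: "integral {0..T} (\<lambda>t. legendre_clebsch_form ?A Q G Y N (W t)) = h * \<beta>" by simp
    have "integral {0..T} (\<lambda>t. norm (W t)) = integral {0..T} (\<lambda>t. if t \<in> ?I then norm (F ((t - a) / h)) else 0)"
      by (intro integral_cong) (simp add: W_def)
    also have "\<dots> = h *\<^sub>R \<rho>"
      unfolding \<rho>_def by (rule rescale) (intro continuous_intros F)
    finally have 3: "integral {0..T} (\<lambda>t. norm (W t)) = h * \<rho>" by simp
    show ?thesis using nonneg le unfolding 1 2 3 by (simp add: power_mult_distrib mult_ac)
  qed
  have d: "0 < b - a" using ab by simp
  show "0 \<le> \<alpha>" by (rule nonneg_expansion_coefficients(1)[OF d expand])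
  show "0 \<le> \<beta>" if "\<alpha> = 0" by (rule nonneg_expansion_coefficients(2)[OF d expand that])
qed

text \<open>
  For a loop in the plane of the \<open>i\<close>-th and \<open>j\<close>-th controls, the symmetric part of \<open>(C G)\<^sup>T N\<close>, where
  \<open>C = G\<^sup>T Q\<close>, contributes an exact differential to the first term of the expansion, and the antisymmetric part contributes its
  entry times twice the enclosed area. The loop \<open>(s - s\<^sup>2, s\<^sup>2 - s\<^sup>3)\<close> serves because it is polynomial,
  closed, and encloses a nonzero area. Exchanging \<open>i\<close> and \<open>j\<close> reverses the inequality.
\<close>

lemma goh_inequality:
  assumes opt: "optimal_control T J R Q G Y N l lo hi x0 u x"
    and ab: "0 \<le> a" "a < b" "b \<le> T"
    and interior: "AE t in lebesgue_on {a<..<b}. \<forall>k\<in>{i, j}. lo $ k < u t $ k \<and> u t $ k < hi $ k"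
  shows "column i N \<bullet> ((transpose G ** Q) *v column j G) \<le> column j N \<bullet> ((transpose G ** Q) *v column i G)"
proof -
  let ?H = "transpose G ** Q"
  define F where "F s = (s - s\<^sup>2) *\<^sub>R axis i 1 + (s\<^sup>2 - s^3) *\<^sub>R axis j (1::real)" for s :: real
  define F' where "F' s = (1 - 2 * s) *\<^sub>R axis i 1 + (2 * s - 3 * s\<^sup>2) *\<^sub>R axis j (1::real)" for s :: real
  define p where "p k m = (?H *v column k G) \<bullet> column m N" for k m
  \<comment> \<open>An antiderivative of the integrand in the first term of the expansion.\<close>
  define P where "P s = (s - s\<^sup>2)\<^sup>2 / 2 * p i i + (2/3 * s^3 - 5/4 * s^4 + 3/5 * s^5) * p i j
      + (1/3 * s^3 - 3/4 * s^4 + 2/5 * s^5) * p j i + (s\<^sup>2 - s^3)\<^sup>2 / 2 * p j j" for s :: real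
  have "0 \<le> integral {0..1} (\<lambda>s. (?H *v (G *v F s)) \<bullet> (N *v F' s))"
  proof (rule shrinking_loop_conditions(1)[OF opt ab interior])
    show "(F has_vector_derivative F' s) (at s)" for s
    proof -
      have "((\<lambda>s. s - s\<^sup>2) has_real_derivative 1 - 2 * s) (at s)"
        "((\<lambda>s. s\<^sup>2 - s^3) has_real_derivative 2 * s - 3 * s\<^sup>2) (at s)"
        by (auto intro!: derivative_eq_intros)
      then show ?thesis unfolding F_def[abs_def] F'_def
        using has_vector_derivative_add has_vector_derivative_scaleR[OF _ has_vector_derivative_const]
        by fastforce
    qed
    show "continuous_on UNIV F'" unfolding F'_def[abs_def] by (intro continuous_intros)
    show "F 0 = 0" "F 1 = 0" by (simp_all add: F_def)
    show "F' s $ k = 0" if "k \<notin> {i, j}" for s k using that by (simp add: F'_def axis_def)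
  qed
  also have "integral {0..1} (\<lambda>s. (?H *v (G *v F s)) \<bullet> (N *v F' s)) = P 1 - P 0"
  proof (rule integral_unique[OF fundamental_theorem_of_calculus])
    fix s :: real
    have "(P has_real_derivative (s - s\<^sup>2) * (1 - 2 * s) * p i i + (s - s\<^sup>2) * (2 * s - 3 * s\<^sup>2) * p i j
        + (s\<^sup>2 - s^3) * (1 - 2 * s) * p j i + (s\<^sup>2 - s^3) * (2 * s - 3 * s\<^sup>2) * p j j) (at s within {0..1})"
      unfolding P_def[abs_def]
      by (auto intro!: derivative_eq_intros simp: field_simps power2_eq_square power3_eq_cube power4_eq_xxxx)
    also have "(s - s\<^sup>2) * (1 - 2 * s) * p i i + (s - s\<^sup>2) * (2 * s - 3 * s\<^sup>2) * p i j
        + (s\<^sup>2 - s^3) * (1 - 2 * s) * p j i + (s\<^sup>2 - s^3) * (2 * s - 3 * s\<^sup>2) * p j j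
        = (?H *v (G *v F s)) \<bullet> (N *v F' s)"
      by (simp add: F_def F'_def p_def matrix_vector_right_distrib matrix_vector_mult_scaleR
          matrix_vector_mult_basis inner_add_left inner_add_right distrib_left mult_ac)
    finally show "(P has_vector_derivative (?H *v (G *v F s)) \<bullet> (N *v F' s)) (at s within {0..1})"
      by (simp add: has_real_derivative_iff_has_vector_derivative)
  qed simp
  also have "P 1 - P 0 = (p i j - p j i) / 60" by (simp add: P_def field_simps)
  finally show ?thesis by (simp add: p_def inner_commute)
qed

text \<open>
  A loop that runs forth and back along the fixed direction \<open>v\<close> encloses no area. The first term of the
  expansion therefore vanishes, whatever \<open>v\<close> is, and the Legendre-Clebsch term decides.
\<close>

lemma legendre_clebsch_form_nonneg:
  assumes opt: "optimal_control T J R Q G Y N l lo hi x0 u x"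
    and ab: "0 \<le> a" "a < b" "b \<le> T"
    and interior: "AE t in lebesgue_on {a<..<b}. \<forall>k\<in>I. lo $ k < u t $ k \<and> u t $ k < hi $ k"
    and v: "\<And>k. k \<notin> I \<Longrightarrow> v $ k = 0"
  shows "0 \<le> legendre_clebsch_form ((J - R) ** Q) Q G Y N v"
proof -
  let ?H = "transpose G ** Q" and ?A = "(J - R) ** Q"
  define F where "F s = (s - s\<^sup>2) *\<^sub>R v" for s :: real
  define F' where "F' s = (1 - 2 * s) *\<^sub>R v" for s :: real
  define q where "q = (?H *v (G *v v)) \<bullet> (N *v v)"
  have "integral {0..1} (\<lambda>s. (?H *v (G *v F s)) \<bullet> (N *v F' s))
      = (1 - 1\<^sup>2)\<^sup>2 / 2 * q - (0 - 0\<^sup>2)\<^sup>2 / 2 * q"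
  proof (rule integral_unique[OF fundamental_theorem_of_calculus])
    fix s :: real
    have "((\<lambda>s. (s - s\<^sup>2)\<^sup>2 / 2 * q) has_real_derivative (s - s\<^sup>2) * (1 - 2 * s) * q) (at s within {0..1})"
      by (auto intro!: derivative_eq_intros simp: field_simps power2_eq_square)
    then show "((\<lambda>s. (s - s\<^sup>2)\<^sup>2 / 2 * q) has_vector_derivative (?H *v (G *v F s)) \<bullet> (N *v F' s)) (at s within {0..1})"
      by (simp add: F_def F'_def q_def matrix_vector_mult_scaleR has_real_derivative_iff_has_vector_derivative mult_ac)
  qed simp
  then have zero: "integral {0..1} (\<lambda>s. (?H *v (G *v F s)) \<bullet> (N *v F' s)) = 0" by simp
  have "0 \<le> integral {0..1} (\<lambda>s. legendre_clebsch_form ?A Q G Y N (F s))"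
  proof (rule shrinking_loop_conditions(2)[OF opt ab interior _ _ _ _ _ zero])
    show "(F has_vector_derivative F' s) (at s)" for s
    proof -
      have "((\<lambda>s. s - s\<^sup>2) has_real_derivative 1 - 2 * s) (at s)"
        by (auto intro!: derivative_eq_intros)
      then show ?thesis unfolding F_def[abs_def] F'_def
        using has_vector_derivative_scaleR[OF _ has_vector_derivative_const] by fastforce
    qed
    show "continuous_on UNIV F'" unfolding F'_def[abs_def] by (intro continuous_intros)
    show "F 0 = 0" "F 1 = 0" by (simp_all add: F_def)
    show "F' s $ k = 0" if "k \<notin> I" for s k using v[OF that] by (simp add: F'_def)
  qed
  also have "integral {0..1} (\<lambda>s. legendre_clebsch_form ?A Q G Y N (F s))
      = (1^3 / 3 - 1^4 / 2 + 1^5 / 5) * legendre_clebsch_form ?A Q G Y N v - (0^3 / 3 - 0^4 / 2 + 0^5 / 5) * legendre_clebsch_form ?A Q G Y N v"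
  proof (rule integral_unique[OF fundamental_theorem_of_calculus])
    fix s :: real
    have "((\<lambda>s. (s^3 / 3 - s^4 / 2 + s^5 / 5) * legendre_clebsch_form ?A Q G Y N v) has_real_derivative
        (s - s\<^sup>2)\<^sup>2 * legendre_clebsch_form ?A Q G Y N v) (at s within {0..1})"
      by (auto intro!: derivative_eq_intros simp: field_simps power2_eq_square power3_eq_cube power4_eq_xxxx)
    then show "((\<lambda>s. (s^3 / 3 - s^4 / 2 + s^5 / 5) * legendre_clebsch_form ?A Q G Y N v) has_vector_derivative
        legendre_clebsch_form ?A Q G Y N (F s)) (at s within {0..1})"
      by (simp add: F_def legendre_clebsch_form_scaleR has_real_derivative_iff_has_vector_derivative)
  qed simp
  finally show ?thesis by (simp add: zero_le_divide_iff)
qed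

section \<open>Lie brackets and matrix forms of the conditions\<close>

lemma lie_bracket_control_fields:
  "lie_bracket (control_field Q G N l i) (control_field Q G N l j) z =
     (0, column i G \<bullet> ((Q ** G) *v column j N) - column j G \<bullet> ((Q ** G) *v column i N))"
proof -
  have "(control_field Q G N l k has_derivative (\<lambda>h. (0, fst h \<bullet> ((Q ** G) *v column k N)))) (at z)" for k
    unfolding control_field_def[abs_def] by (auto intro!: derivative_eq_intros)
  then have "frechet_derivative (control_field Q G N l k) (at z) = (\<lambda>h. (0, fst h \<bullet> ((Q ** G) *v column k N)))" for k
    by (metis frechet_derivative_at)
  then show ?thesis by (simp add: lie_bracket_def control_field_def)
qed

lemma inner_transpose_mult: "x \<bullet> (transpose M *v y) = (M *v x) \<bullet> y" for M :: "real^'a^'b"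
  by (metis dot_lmul_matrix inner_commute transpose_matrix_vector)

lemma col_submatrix_mult:
  assumes "\<And>k. k \<notin> I \<Longrightarrow> v $ k = 0" shows "col_submatrix I M *v v = M *v v"
  using assms by (auto simp: col_submatrix_def matrix_vector_mult_def vec_eq_iff intro!: sum.cong)

lemma neg_semidef_onI:
  fixes M :: "real^'k^'k"
  assumes sym: "transpose M = M" and neg: "\<And>v. (\<And>k. k \<notin> I \<Longrightarrow> v $ k = 0) \<Longrightarrow> v \<bullet> (M *v v) \<le> 0"
  shows "neg_semidef_on I M"
  unfolding neg_semidef_on_def
proof (intro conjI ballI allI)
  fix i j show "M $ i $ j = M $ j $ i" using sym by (metis transpose_def vec_lambda_beta)
next
  fix v :: "'k \<Rightarrow> real"
  define w :: "real^'k" where "w = (\<chi> k. if k \<in> I then v k else 0)"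
  have "(\<Sum>i\<in>I. \<Sum>j\<in>I. v i * M $ i $ j * v j) = (\<Sum>i\<in>UNIV. \<Sum>j\<in>UNIV. w $ i * M $ i $ j * w $ j)"
  proof -
    have "(\<Sum>j\<in>I. v i * M $ i $ j * v j) = (\<Sum>j\<in>UNIV. v i * M $ i $ j * w $ j)" for i
      by (rule sum.mono_neutral_cong_left) (auto simp: w_def)
    then show ?thesis by (intro sum.mono_neutral_cong_left) (auto simp: w_def)
  qed
  also have "\<dots> = w \<bullet> (M *v w)"
    by (simp add: inner_vec_def matrix_vector_mult_def sum_distrib_left mult.assoc)
  also have "\<dots> \<le> 0" by (rule neg) (simp add: w_def)
  finally show "(\<Sum>i\<in>I. \<Sum>j\<in>I. v i * M $ i $ j * v j) \<le> 0" .
qed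

theorem theorem4p4:
  fixes J R Q :: "real^'n^'n" and G :: "real^'m^'n" and Y N :: "real^'m^'m"
    and l lo hi :: "real^'m" and x0 :: "real^'n" and T :: real
    and u :: "real \<Rightarrow> real^'m" and x lam :: "real \<Rightarrow> real^'n"
  assumes "0 < T"
    and "transpose J = - J" and "pos_semidef R" and "pos_def Q"
    and "rank G = CARD('m)" and "CARD('m) \<le> CARD('n)"
    and "pos_semidef Y"
    and "\<And>i. lo $ i \<le> hi $ i"
    and "optimal_control T J R Q G Y N l lo hi x0 u x"
    and "adjoint_state T J R Q G Y N u x lam"
  shows "(\<forall>i j a b.
            0 \<le> a \<and> a < b \<and> b \<le> T \<and>
            (AE t in lebesgue_on {a<..<b}.
               lo $ i < u t $ i \<and> u t $ i < hi $ i \<and> lo $ j < u t $ j \<and> u t $ j < hi $ j) \<longrightarrow>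
            (\<forall>t\<in>{a<..<b}.
               (lam t, 1) \<bullet> lie_bracket (control_field Q G N l i) (control_field Q G N l j)
                             (x t, cost Q G Y N l u x t)
               = column j N \<bullet> ((transpose G ** Q) *v column i G)
                 - column i N \<bullet> ((transpose G ** Q) *v column j G)) \<and>
            column j N \<bullet> ((transpose G ** Q) *v column i G)
            - column i N \<bullet> ((transpose G ** Q) *v column j G) = 0)
       \<and>
         (\<forall>I a b.
            0 \<le> a \<and> a < b \<and> b \<le> T \<and>
            (AE t in lebesgue_on {a<..<b}. t \<in> (\<Inter>i\<in>I. interior_times T lo hi u i)) \<longrightarrow>
            (let A = (J - R) ** Q; G\<^sub>I = col_submatrix I G; N\<^sub>I = col_submatrix I N in
             neg_semidef_on I
               (transpose N\<^sub>I ** transpose G ** Q ** A ** G\<^sub>I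
                - 2 *\<^sub>R (transpose G\<^sub>I ** Q ** G ** Y ** transpose G ** Q ** G\<^sub>I)
                + transpose (transpose N\<^sub>I ** transpose G ** Q ** A ** G\<^sub>I))))"
proof (intro conjI allI impI ballI; (elim conjE)?)
  have Q: "transpose Q = Q" and Y: "transpose Y = Y"
    using assms unfolding pos_def_def pos_semidef_def by auto
  note opt = \<open>optimal_control T J R Q G Y N l lo hi x0 u x\<close>
  show "(lam t, 1) \<bullet> lie_bracket (control_field Q G N l i) (control_field Q G N l j)
                             (x t, cost Q G Y N l u x t)
               = column j N \<bullet> ((transpose G ** Q) *v column i G)
                 - column i N \<bullet> ((transpose G ** Q) *v column j G)" for i j t
  proof -
    have "column k G \<bullet> ((Q ** G) *v column m N) = column m N \<bullet> ((transpose G ** Q) *v column k G)" for k m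
      using inner_transpose_mult[of "column m N" "Q ** G" "column k G"]
      by (simp add: matrix_transpose_mul Q inner_commute)
    then show ?thesis by (simp add: lie_bracket_control_fields)
  qed
  show "column j N \<bullet> ((transpose G ** Q) *v column i G)
            - column i N \<bullet> ((transpose G ** Q) *v column j G) = 0"
    if "0 \<le> a" "a < b" "b \<le> T" and ae: "AE t in lebesgue_on {a<..<b}.
               lo $ i < u t $ i \<and> u t $ i < hi $ i \<and> lo $ j < u t $ j \<and> u t $ j < hi $ j" for i j a b
  proof -
    have "AE t in lebesgue_on {a<..<b}. \<forall>k\<in>{i, j}. lo $ k < u t $ k \<and> u t $ k < hi $ k"
      using ae by eventually_elim auto
    from goh_inequality[OF opt that(1-3) this]
    have le: "column i N \<bullet> ((transpose G ** Q) *v column j G) \<le> column j N \<bullet> ((transpose G ** Q) *v column i G)" .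
    have "AE t in lebesgue_on {a<..<b}. \<forall>k\<in>{j, i}. lo $ k < u t $ k \<and> u t $ k < hi $ k"
      using ae by eventually_elim auto
    from goh_inequality[OF opt that(1-3) this] le show ?thesis by simp
  qed
  fix I a b
  assume ab: "0 \<le> a" "a < b" "b \<le> T"
    and ae: "AE t in lebesgue_on {a<..<b}. t \<in> (\<Inter>i\<in>I. interior_times T lo hi u i)"
  have interior: "AE t in lebesgue_on {a<..<b}. \<forall>k\<in>I. lo $ k < u t $ k \<and> u t $ k < hi $ k"
    using ae by eventually_elim (auto simp: interior_times_def)
  define A where "A = (J - R) ** Q"
  define G' where "G' = col_submatrix I G"
  define N' where "N' = col_submatrix I N"
  define X where "X = transpose N' ** transpose G ** Q ** A ** G'"
  define Z where "Z = transpose G' ** Q ** G ** Y ** transpose G ** Q ** G'"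
  have "neg_semidef_on I (X - 2 *\<^sub>R Z + transpose X)"
  proof (rule neg_semidef_onI)
    have "transpose Z = Z"
      unfolding Z_def by (simp add: matrix_transpose_mul Q Y matrix_mul_assoc)
    then show "transpose (X - 2 *\<^sub>R Z + transpose X) = X - 2 *\<^sub>R Z + transpose X"
      by (simp add: transpose_def vec_eq_iff)
    fix v :: "real^'m" assume v: "\<And>k. k \<notin> I \<Longrightarrow> v $ k = 0"
    have Gv: "G' *v v = G *v v" unfolding G'_def by (rule col_submatrix_mult[OF v])
    have Nv: "N' *v v = N *v v" unfolding N'_def by (rule col_submatrix_mult[OF v])
    let ?H = "transpose G ** Q"
    have "v \<bullet> (X *v v) = v \<bullet> (transpose N' *v (?H *v (A *v (G *v v))))"
      by (simp add: X_def Gv matrix_vector_mul_assoc[symmetric])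
    then have X: "v \<bullet> (X *v v) = (?H *v (A *v (G *v v))) \<bullet> (N *v v)"
      by (simp only: inner_transpose_mult Nv inner_commute)
    have "v \<bullet> (Z *v v) = v \<bullet> (transpose G' *v (transpose ?H *v (Y *v (?H *v (G *v v)))))"
      by (simp add: Z_def Gv matrix_vector_mul_assoc[symmetric] matrix_transpose_mul Q)
    then have Z: "v \<bullet> (Z *v v) = (?H *v (G *v v)) \<bullet> (Y *v (?H *v (G *v v)))"
      by (simp only: inner_transpose_mult Gv)
    have "v \<bullet> (transpose X *v v) = v \<bullet> (X *v v)"
      by (simp only: inner_transpose_mult inner_commute)
    then have "v \<bullet> ((X - 2 *\<^sub>R Z + transpose X) *v v) = - 2 * legendre_clebsch_form A Q G Y N v"
      by (simp add: matrix_vector_mult_add_rdistrib matrix_vector_mult_diff_rdistrib scaleR_matrix_vector_assoc[symmetric]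
          inner_add_right inner_diff_right X Z legendre_clebsch_form_def Let_def)
    then show "v \<bullet> ((X - 2 *\<^sub>R Z + transpose X) *v v) \<le> 0"
      using legendre_clebsch_form_nonneg[OF opt ab interior v] by (simp add: A_def)
  qed
  then show "let A = (J - R) ** Q; G\<^sub>I = col_submatrix I G; N\<^sub>I = col_submatrix I N in
             neg_semidef_on I
               (transpose N\<^sub>I ** transpose G ** Q ** A ** G\<^sub>I
                - 2 *\<^sub>R (transpose G\<^sub>I ** Q ** G ** Y ** transpose G ** Q ** G\<^sub>I)
                + transpose (transpose N\<^sub>I ** transpose G ** Q ** A ** G\<^sub>I))"
    unfolding Let_def X_def Z_def A_def G'_def N'_def .
qed

end
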